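(* Let $\theta\in(0,1)$ be irrational and $x\in[0,1)$, and let $\theta_n,\delta_n,I_n,I'_{n+1},\varphi_n,\sigma_n,\tilde I_n,\Psi,\sigma'_n,\omega'_n$ be as in the context. Infinitely many of the substitutions $\sigma_n$ are not the identity, and the following hold. (1) (Arbitrary point.) Let $x_0$ be the point $x$ of $I_0$ if $x\notin\mathcal D_\theta$, and one of the two points $x^{+},x^{-}$ of $I_0$ if $x\in\mathcal D_\theta$. Inductively, for $n\ge 0$, choose any integer $j_n\ge 0$ with $R_{\theta_n}^{j_n}(x_n)\in I'_{n+1}$ (such $j_n$ exists), let $\omega_n\in\{A,B,C\}^*$ be the word of length $j_n$ which encodes the first $j_n$ points $x_n,R_{\theta_n}x_n,\dots,R_{\theta_n}^{j_n-1}x_n$ of the orbit of $x_n$ in $I_n$ (so $\omega_n$ may be empty), and put $x_{n+1}=\varphi_n(R_{\theta_n}^{j_n}(x_n))\in I_{n+1}$. Then the infinite word $$\omega_0\,\sigma_0\bigl(\omega_1\,\sigma_1\bigl(\omega_2\,\sigma_2(\cdots)\bigr)\bigr)$$ encodes the orbit of $x$ under rotation by $\theta$ with respect to the half-open partition $A,B,C$ of $[0,1)$ up to at most two errors (i.e. it differs from the coding of the orbit in at most two positions). Alternately, the coding is exact up to a change of endpoints of the intervals $A$, $B$, $C$. (2) (Special point.) There is one special point $x(\theta)$, the point of $\bigcap_{n\ge0}\tilde I_n$, for which all $\omega_n$ may be taken to be the empty word; and for every nonempty finite word $\omega\in\{A,B,C\}^*$ the infinite word $$\lim_{n\to\infty}(\sigma_0\circ\sigma_1\circ\cdots\circ\sigma_{n-1})(\omega)$$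 exists and encodes the orbit of $x(\theta)$ (in the split circle; hence, for the corresponding point of $[0,1)$ and the half-open partition, up to at most two errors, or exactly up to a change of endpoints). (3) (Orbit of zero.) The infinite word $$\lim_{n\to\infty}(\sigma'_0\circ\sigma'_1\circ\cdots\circ\sigma'_{n-1})(\omega'_{n})$$ exists and encodes the orbit of $0$ (that is, of $0^+$).
   Context: Words and substitutions. $\{A,B,C\}^*$ is the free monoid of finite words (including the empty word $\emptyset$). A substitution is a map $\{A,B,C\}\to\{A,B,C\}^*$ extended to finite words as a monoid homomorphism and to infinite words letter by letter. A limit of finite words is the infinite word to which they converge letter by letter (with lengths tending to infinity). The infinite word $\omega_0\sigma_0(\omega_1\sigma_1(\omega_2\sigma_2(\cdots)))$ means: if infinitely many $\omega_n$ are nonempty, the limit of the words $\omega_0\,\sigma_0(\omega_1)\,(\sigma_0\circ\sigma_1)(\omega_2)\cdots(\sigma_0\circ\cdots\circ\sigma_{n-1})(\omega_n)$; if $\omega_n=\emptyset$ for all $n\ge N$, the word $\omega_0\sigma_0(\omega_1)\cdots(\sigma_0\circ\cdots\circ\sigma_{N-2})(\omega_{N-1})$ followed by $(\sigma_0\circ\cdots\circ\sigma_{N-1})\bigl(\lim_{m}(\sigma_N\circ\cdots\circ\sigma_{m})(A)\bigr)$. Half-open partition of $[0,1)$. If $\theta<1/2$: $A=[0,1/2)$, $B=[1/2,1-\theta)$, $C=[1-\theta,1)$. If $\theta>1/2$: $C=[0,1-\theta)$, $B=[1-\theta,1/2)$, $A=[1/2,1)$. A word $w=w_0w_1\cdots$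 encodes the orbit of $x$ if for every index $i$ the letter $w_i$ names the partition element containing $x+i\theta \bmod 1$. A change of endpoints means changing to which of the adjacent intervals some of the endpoints $0,1/2,1-\theta$ belong. Split circle. For irrational $\theta\in(0,1)$ let $\mathcal D_\theta=\{-i\theta,\,-i\theta+1/2 \bmod 1: i=0,1,2,\dots\}$. Replace every $x\in\mathcal D_\theta$ by two points $x^-<x^+$ (left and right limits; $0^-$ is written $1^-$), giving a split circle $[0^+,1^-]$ with its natural order. Rotation $R_\theta$ is $x\mapsto x+\theta$, with $x^\pm\mapsto(x+\theta)^\pm$ if $x,x+\theta\in\mathcal D_\theta$, and $R_\theta(0^+)=R_\theta(1^-)=\theta$, $R_\theta((1/2)^\pm)=1/2+\theta$. The split circle is partitioned into closed intervals: if $\theta<1/2$, $A=[0^+,(1/2)^-]$, $B=[(1/2)^+,(1-\theta)^-]$, $C=[(1-\theta)^+,1^-]$; if $\theta>1/2$, $C=[0^+,(1-\theta)^-]$, $B=[(1-\theta)^+,(1/2)^-]$, $A=[(1/2)^+,1^-]$. Encoding of orbits in the split circle is defined with respect to this partition. Renormalization. Write $\theta=[a_1,a_2,\dots]$ for the continued fraction $1/(a_1+1/(a_2+\cdots))$, $a_i=a_i(\theta)$. Define $g(\theta)=[a_3,a_4,\dots]$ if $a_1$ is even; $g(\theta)=[1,a_2,a_3,\dots]$ if $a_1$ is odd and $a_1\ne1$; $g(\theta)=[a_2+1,a_3,\dots]=1-\theta$ if $a_1=1$. Let $E(t)$ be the largest even integer $\le t$. Put $\theta_n=g^n(\theta)$,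 $\delta_n=1-E(a_1(\theta_n))\theta_n$, let $I_n$ be the split circle for $\theta_n$ with rotation $R_{\theta_n}$ and the partition for $\theta_n$, and let $I'_{n+1}=[0^+,\delta_n^-]\subset I_n$ (equal to $I_n$ when $\theta_n>1/2$). Let $\varphi_n:I'_{n+1}\to I_{n+1}$ be $\varphi_n(x)=1-x$ (interchanging the signs $\pm$) if $a_1(\theta_n)=1$ and $\varphi_n(x)=\delta_n^{-1}x$ (preserving the signs) otherwise. Let $\tilde I_n=(\varphi_0^{-1}\circ\cdots\circ\varphi_{n-1}^{-1})(I_n)\subset I_0$. The substitution $\sigma_n=\sigma(\theta_n)$, where for $\theta=[a_1,a_2,a_3,\dots]$ the substitution $\sigma(\theta)$ is: - $a_1=2k$, $a_3\ne1$: $A\mapsto(A^{k+1}B^{k-1}C)(A^kB^{k-1}C)^{a_2-1}$, $B\mapsto(A^kB^kC)(A^kB^{k-1}C)^{a_2-1}$, $C\mapsto(A^kB^kC)(A^kB^{k-1}C)^{a_2}$; - $a_1=2k$, $a_3=1$: $A\mapsto(A^kB^kC)(A^kB^{k-1}C)^{a_2}$, $B\mapsto(A^{k+1}B^{k-1}C)(A^kB^{k-1}C)^{a_2}$, $C\mapsto(A^{k+1}B^{k-1}C)(A^kB^{k-1}C)^{a_2-1}$; - $a_1=2k+1$, $k\ge1$: $A\mapsto A^kB^kC$, $B\mapsto A^{k+1}B^{k-1}C$, $C\mapsto A$; - $a_1=1$: the identity. Orbit of zero. $\Psi$ is the map on nonempty (finite or infinite) words replacing the first letter by $C$ and leaving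 all other letters unchanged. $\sigma'_n=\sigma_n$ if $\theta_n<1/2$ and $\sigma'_n=\Psi$ if $\theta_n>1/2$. The words $\omega'_n$ are: $\omega'_n=A^{k+1}B^{k-1}C$ if $a_1(\theta_n)=2k$; $\omega'_n=A^{k+1}B^k$ if $a_1(\theta_n)=2k+1$ with $k\ge1$; $\omega'_n=\Psi(\omega'_{n+1})$ if $a_1(\theta_n)=1$ (then $a_1(\theta_{n+1})\neq1$). *)

theory Defs
  imports Complex_Main "HOL-Library.Omega_Words_Fun"
begin

section \<open>Words and substitutions\<close>

datatype letter = A | B | C

definition word_power :: "letter list \<Rightarrow> nat \<Rightarrow> letter list" where
  "word_power w n = concat (replicate n w)"

definition apply_subst :: "(letter \<Rightarrow> letter list) \<Rightarrow> letter list \<Rightarrow> letter list" where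
  "apply_subst s w = concat (map s w)"

text \<open>Letterwise convergence of finite words to an infinite word; the condition
  \<open>i < length (W n)\<close>, eventually for each \<open>i\<close>, says that the lengths tend to infinity.\<close>

definition word_limit :: "(nat \<Rightarrow> letter list) \<Rightarrow> letter word \<Rightarrow> bool" where
  "word_limit W u \<longleftrightarrow> (\<forall>i. \<forall>\<^sub>F n in sequentially. i < length (W n) \<and> W n ! i = u i)"

text \<open>For a sequence \<open>F\<close> of maps on finite words, \<open>compose_seg F m n\<close> is
  \<open>F m \<circ> F (m+1) \<circ> \<dots> \<circ> F (n-1)\<close> (the identity if \<open>n \<le> m\<close>).\<close>

definition compose_seg ::
    "(nat \<Rightarrow> letter list \<Rightarrow> letter list) \<Rightarrow> nat \<Rightarrow> nat \<Rightarrow> letter list \<Rightarrow> letter list" where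
  "compose_seg F m n = foldr F [m..<n]"

text \<open>\<open>nested_prefix s \<omega> n\<close> is
  \<open>\<omega>\<^sub>0 s\<^sub>0(\<omega>\<^sub>1) (s\<^sub>0 \<circ> s\<^sub>1)(\<omega>\<^sub>2) \<dots> (s\<^sub>0 \<circ> \<dots> \<circ> s\<^sub>n\<^sub>-\<^sub>2)(\<omega>\<^sub>n\<^sub>-\<^sub>1)\<close>.\<close>

definition nested_prefix ::
    "(nat \<Rightarrow> letter \<Rightarrow> letter list) \<Rightarrow> (nat \<Rightarrow> letter list) \<Rightarrow> nat \<Rightarrow> letter list" where
  "nested_prefix s \<omega> n =
     concat (map (\<lambda>i. compose_seg (\<lambda>m. apply_subst (s m)) 0 i (\<omega> i)) [0..<n])"

text \<open>\<open>nested_word s \<omega> u\<close>: the infinite word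
  \<open>\<omega>\<^sub>0 s\<^sub>0(\<omega>\<^sub>1 s\<^sub>1(\<omega>\<^sub>2 s\<^sub>2(\<dots>)))\<close> exists and equals \<open>u\<close>. In the second case \<open>v\<close> is
  \<open>lim\<^sub>m (s\<^sub>N \<circ> \<dots> \<circ> s\<^sub>m)(A)\<close>, and \<open>v'\<close> is its image under \<open>s\<^sub>0 \<circ> \<dots> \<circ> s\<^sub>N\<^sub>-\<^sub>1\<close>,
  extended letter by letter, that is, the limit of the images of the finite prefixes of \<open>v\<close>.\<close>

definition nested_word ::
    "(nat \<Rightarrow> letter \<Rightarrow> letter list) \<Rightarrow> (nat \<Rightarrow> letter list) \<Rightarrow> letter word \<Rightarrow> bool" where
  "nested_word s \<omega> u \<longleftrightarrow>
     (if infinite {n. \<omega> n \<noteq> []}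
      then word_limit (\<lambda>n. nested_prefix s \<omega> (Suc n)) u
      else \<forall>N. (\<forall>n\<ge>N. \<omega> n = []) \<longrightarrow>
        (\<exists>v v'. word_limit (\<lambda>m. compose_seg (\<lambda>i. apply_subst (s i)) N (Suc m) [A]) v \<and>
                word_limit (\<lambda>m. compose_seg (\<lambda>i. apply_subst (s i)) 0 N (map v [0..<m])) v' \<and>
                u = nested_prefix s \<omega> N \<frown> v'))"


section \<open>Coding in \<open>[0,1)\<close>\<close>

definition half_open_part :: "real \<Rightarrow> letter \<Rightarrow> real set" where
  "half_open_part \<theta> l =
     (if \<theta> < 1/2
      then (case l of A \<Rightarrow> {0..<1/2} | B \<Rightarrow> {1/2..<1-\<theta>} | C \<Rightarrow> {1-\<theta>..<1})
      else (case l of A \<Rightarrow> {1/2..<1} | B \<Rightarrow> {1-\<theta>..<1/2} | C \<Rightarrow> {0..<1-\<theta>}))"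

definition encodes_orbit :: "(letter \<Rightarrow> real set) \<Rightarrow> real \<Rightarrow> real \<Rightarrow> letter word \<Rightarrow> bool" where
  "encodes_orbit P \<theta> x u \<longleftrightarrow> (\<forall>i. frac (x + real i * \<theta>) \<in> P (u i))"

definition encodes_up_to_two_errors :: "real \<Rightarrow> real \<Rightarrow> letter word \<Rightarrow> bool" where
  "encodes_up_to_two_errors \<theta> x u \<longleftrightarrow>
     finite {i. frac (x + real i * \<theta>) \<notin> half_open_part \<theta> (u i)} \<and>
     card {i. frac (x + real i * \<theta>) \<notin> half_open_part \<theta> (u i)} \<le> 2"

text \<open>On the circle the endpoint \<open>0\<close> is adjacent to the intervals \<open>A\<close> and \<open>C\<close>, \<open>1/2\<close> to
  \<open>A\<close> and \<open>B\<close>, and \<open>1 - \<theta>\<close> to \<open>B\<close> and \<open>C\<close>, both for \<open>\<theta> < 1/2\<close> and for \<open>\<theta> > 1/2\<close>.\<close>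

definition endpoint_change :: "real \<Rightarrow> (letter \<Rightarrow> real set) \<Rightarrow> bool" where
  "endpoint_change \<theta> P \<longleftrightarrow>
     (\<forall>l. P l \<subseteq> {0..<1}) \<and>
     (\<forall>y\<in>{0..<1}. \<exists>!l. y \<in> P l) \<and>
     (\<forall>l. P l - {0, 1/2, 1-\<theta>} = half_open_part \<theta> l - {0, 1/2, 1-\<theta>}) \<and>
     0 \<in> P A \<union> P C \<and> 1/2 \<in> P A \<union> P B \<and> 1-\<theta> \<in> P B \<union> P C"

definition encodes_up_to_endpoints :: "real \<Rightarrow> real \<Rightarrow> letter word \<Rightarrow> bool" where
  "encodes_up_to_endpoints \<theta> x u \<longleftrightarrow> (\<exists>P. endpoint_change \<theta> P \<and> encodes_orbit P \<theta> x u)"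


section \<open>The split circle\<close>

text \<open>\<open>Pt x\<close>, \<open>PtM x\<close>, \<open>PtP x\<close> stand for \<open>x\<close>, \<open>x\<^sup>-\<close>, \<open>x\<^sup>+\<close>.\<close>

datatype split_point = PtM real | Pt real | PtP real

primrec position :: "split_point \<Rightarrow> real" where
  "position (PtM x) = x"
| "position (Pt x) = x"
| "position (PtP x) = x"

primrec side :: "split_point \<Rightarrow> int" where
  "side (PtM x) = -1"
| "side (Pt x) = 0"
| "side (PtP x) = 1"

definition split_le :: "split_point \<Rightarrow> split_point \<Rightarrow> bool" where
  "split_le p q \<longleftrightarrow> position p < position q \<or> position p = position q \<and> side p \<le> side q"

definition split_set :: "real \<Rightarrow> real set" where
  "split_set \<theta> = (\<Union>i. {frac (- real i * \<theta>), frac (- real i * \<theta> + 1/2)})"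

text \<open>The left limit at a point of \<open>[0,1)\<close>; \<open>0\<^sup>-\<close> is written \<open>1\<^sup>-\<close>.\<close>

definition minus_pt :: "real \<Rightarrow> split_point" where
  "minus_pt x = (if x = 0 then PtM 1 else PtM x)"

definition lifts :: "real \<Rightarrow> real \<Rightarrow> split_point set" where
  "lifts \<theta> x = (if x \<in> split_set \<theta> then {minus_pt x, PtP x} else {Pt x})"

definition split_circle :: "real \<Rightarrow> split_point set" where
  "split_circle \<theta> = (\<Union>x\<in>{0..<1}. lifts \<theta> x)"

definition split_interval :: "real \<Rightarrow> split_point \<Rightarrow> split_point \<Rightarrow> split_point set" where
  "split_interval \<theta> p q = {r \<in> split_circle \<theta>. split_le p r \<and> split_le r q}"

text \<open>For irrational \<open>\<theta>\<close>, a point \<open>x \<in> split_set \<theta>\<close> has \<open>x + \<theta> \<notin> split_set \<theta>\<close> exactly for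
  \<open>x = 0\<close> and \<open>x = 1/2\<close>, where the two one-sided points have a common image.\<close>

primrec rot :: "real \<Rightarrow> split_point \<Rightarrow> split_point" where
  "rot \<theta> (Pt x) = Pt (frac (x + \<theta>))"
| "rot \<theta> (PtM x) =
     (if frac (x + \<theta>) \<in> split_set \<theta> then minus_pt (frac (x + \<theta>)) else Pt (frac (x + \<theta>)))"
| "rot \<theta> (PtP x) =
     (if frac (x + \<theta>) \<in> split_set \<theta> then PtP (frac (x + \<theta>)) else Pt (frac (x + \<theta>)))"

definition split_part :: "real \<Rightarrow> letter \<Rightarrow> split_point set" where
  "split_part \<theta> l =
     (if \<theta> < 1/2
      then (case l of A \<Rightarrow> split_interval \<theta> (PtP 0) (PtM (1/2))
                    | B \<Rightarrow> split_interval \<theta> (PtP (1/2)) (PtM (1-\<theta>))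
                    | C \<Rightarrow> split_interval \<theta> (PtP (1-\<theta>)) (PtM 1))
      else (case l of A \<Rightarrow> split_interval \<theta> (PtP (1/2)) (PtM 1)
                    | B \<Rightarrow> split_interval \<theta> (PtP (1-\<theta>)) (PtM (1/2))
                    | C \<Rightarrow> split_interval \<theta> (PtP 0) (PtM (1-\<theta>))))"

definition split_encodes_orbit :: "real \<Rightarrow> split_point \<Rightarrow> letter word \<Rightarrow> bool" where
  "split_encodes_orbit \<theta> p u \<longleftrightarrow> (\<forall>i. (rot \<theta> ^^ i) p \<in> split_part \<theta> (u i))"

definition orbit_word :: "real \<Rightarrow> split_point \<Rightarrow> nat \<Rightarrow> letter list" where
  "orbit_word \<theta> p j = map (\<lambda>i. THE l. (rot \<theta> ^^ i) p \<in> split_part \<theta> l) [0..<j]"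


section \<open>Continued fractions and renormalization\<close>

text \<open>\<open>cf_digit i \<theta>\<close>, for \<open>i \<ge> 1\<close>, is \<open>a\<^sub>i(\<theta>)\<close>.\<close>

definition gauss_map :: "real \<Rightarrow> real" where
  "gauss_map x = frac (1 / x)"

definition cf_digit :: "nat \<Rightarrow> real \<Rightarrow> nat" where
  "cf_digit i \<theta> = nat \<lfloor>1 / (gauss_map ^^ (i - 1)) \<theta>\<rfloor>"

primrec cf_finite :: "nat list \<Rightarrow> real" where
  "cf_finite [] = 0"
| "cf_finite (a # as) = 1 / (real a + cf_finite as)"

text \<open>The value of \<open>[a 1, a 2, \<dots>]\<close>; the argument at \<open>0\<close> is not used.\<close>

definition cf_value :: "(nat \<Rightarrow> nat) \<Rightarrow> real" where
  "cf_value a = lim (\<lambda>n. cf_finite (map a [1..<Suc n]))"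

definition renorm :: "real \<Rightarrow> real" where
  "renorm \<theta> =
     (if even (cf_digit 1 \<theta>) then cf_value (\<lambda>i. cf_digit (i + 2) \<theta>)
      else if cf_digit 1 \<theta> \<noteq> 1 then cf_value (\<lambda>i. if i = 1 then 1 else cf_digit i \<theta>)
      else cf_value (\<lambda>i. if i = 1 then cf_digit 2 \<theta> + 1 else cf_digit (i + 1) \<theta>))"

definition theta_seq :: "real \<Rightarrow> nat \<Rightarrow> real" where
  "theta_seq \<theta> n = (renorm ^^ n) \<theta>"

definition even_floor :: "real \<Rightarrow> int" where
  "even_floor t = (GREATEST m. even m \<and> of_int m \<le> t)"

definition delta :: "real \<Rightarrow> real" where
  "delta \<theta> = 1 - of_int (even_floor (real (cf_digit 1 \<theta>))) * \<theta>"

text \<open>\<open>sub_circle (theta_seq \<theta> n)\<close> and \<open>phi (theta_seq \<theta> n)\<close> are \<open>I'\<^sub>n\<^sub>+\<^sub>1\<close> and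
  \<open>\<phi>\<^sub>n\<close>.\<close>

definition sub_circle :: "real \<Rightarrow> split_point set" where
  "sub_circle \<theta> = split_interval \<theta> (PtP 0) (PtM (delta \<theta>))"

primrec reflect :: "split_point \<Rightarrow> split_point" where
  "reflect (PtM x) = PtP (1 - x)"
| "reflect (Pt x) = Pt (1 - x)"
| "reflect (PtP x) = PtM (1 - x)"

primrec scale :: "real \<Rightarrow> split_point \<Rightarrow> split_point" where
  "scale c (PtM x) = PtM (c * x)"
| "scale c (Pt x) = Pt (c * x)"
| "scale c (PtP x) = PtP (c * x)"

definition phi :: "real \<Rightarrow> split_point \<Rightarrow> split_point" where
  "phi \<theta> p = (if cf_digit 1 \<theta> = 1 then reflect p else scale (inverse (delta \<theta>)) p)"

text \<open>\<open>tilde_circle n \<theta>\<close> is \<open>(\<phi>\<^sub>0\<^sup>-\<^sup>1 \<circ> \<dots> \<circ> \<phi>\<^sub>n\<^sub>-\<^sub>1\<^sup>-\<^sup>1)(I\<^sub>n)\<close>, the preimages taken in the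
  domains \<open>I'\<^sub>i\<^sub>+\<^sub>1\<close> of the maps \<open>\<phi>\<^sub>i\<close>.\<close>

fun tilde_circle :: "nat \<Rightarrow> real \<Rightarrow> split_point set" where
  "tilde_circle 0 \<theta> = split_circle \<theta>"
| "tilde_circle (Suc n) \<theta> = {p \<in> sub_circle \<theta>. phi \<theta> p \<in> tilde_circle n (renorm \<theta>)}"

text \<open>The points \<open>x\<^sub>n\<close> determined by \<open>x\<^sub>0\<close> and the integers \<open>j\<^sub>n\<close>; the choice of \<open>j\<^sub>n\<close> is
  allowed if \<open>R\<^bsup>j\<^sub>n\<^esup>(x\<^sub>n) \<in> I'\<^sub>n\<^sub>+\<^sub>1\<close>.\<close>

primrec renorm_point :: "real \<Rightarrow> split_point \<Rightarrow> (nat \<Rightarrow> nat) \<Rightarrow> nat \<Rightarrow> split_point" where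
  "renorm_point \<theta> x0 j 0 = x0"
| "renorm_point \<theta> x0 j (Suc n) =
     phi (theta_seq \<theta> n) ((rot (theta_seq \<theta> n) ^^ j n) (renorm_point \<theta> x0 j n))"

definition allowed :: "real \<Rightarrow> split_point \<Rightarrow> (nat \<Rightarrow> nat) \<Rightarrow> nat \<Rightarrow> bool" where
  "allowed \<theta> x0 j n \<longleftrightarrow>
     (rot (theta_seq \<theta> n) ^^ j n) (renorm_point \<theta> x0 j n) \<in> sub_circle (theta_seq \<theta> n)"


section \<open>The substitutions\<close>

definition sigma :: "real \<Rightarrow> letter \<Rightarrow> letter list" where
  "sigma \<theta> l =
     (let a1 = cf_digit 1 \<theta>; a2 = cf_digit 2 \<theta>; a3 = cf_digit 3 \<theta>; k = a1 div 2;
          P = word_power [A] (k+1) @ word_power [B] (k-1) @ [C];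
          Q = word_power [A] k @ word_power [B] (k-1) @ [C];
          S = word_power [A] k @ word_power [B] k @ [C]
      in if even a1 then
           (if a3 \<noteq> 1
            then (case l of A \<Rightarrow> P @ word_power Q (a2-1)
                          | B \<Rightarrow> S @ word_power Q (a2-1)
                          | C \<Rightarrow> S @ word_power Q a2)
            else (case l of A \<Rightarrow> S @ word_power Q a2
                          | B \<Rightarrow> P @ word_power Q a2
                          | C \<Rightarrow> P @ word_power Q (a2-1)))
         else if a1 \<noteq> 1 then (case l of A \<Rightarrow> S | B \<Rightarrow> P | C \<Rightarrow> [A])
         else [l])"

primrec psi :: "letter list \<Rightarrow> letter list" where
  "psi [] = []"
| "psi (l # w) = C # w"

definition sigma' :: "real \<Rightarrow> letter list \<Rightarrow> letter list" where
  "sigma' \<theta> = (if \<theta> < 1/2 then apply_subst (sigma \<theta>) else psi)"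

text \<open>The word \<open>\<omega>'\<^sub>n\<close> when \<open>a\<^sub>1(\<theta>\<^sub>n) \<noteq> 1\<close>. If \<open>a\<^sub>1(\<theta>\<^sub>n) = 1\<close>, then
  \<open>a\<^sub>1(\<theta>\<^sub>n\<^sub>+\<^sub>1) \<noteq> 1\<close>, so that the recursion \<open>\<omega>'\<^sub>n = \<Psi>(\<omega>'\<^sub>n\<^sub>+\<^sub>1)\<close> stops after one step.\<close>

definition omega_base :: "real \<Rightarrow> letter list" where
  "omega_base \<theta> =
     (let k = cf_digit 1 \<theta> div 2
      in if even (cf_digit 1 \<theta>) then word_power [A] (k+1) @ word_power [B] (k-1) @ [C]
         else word_power [A] (k+1) @ word_power [B] k)"

definition omega' :: "real \<Rightarrow> letter list" where
  "omega' \<theta> = (if cf_digit 1 \<theta> = 1 then psi (omega_base (renorm \<theta>)) else omega_base \<theta>)"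

end

theory Submission
  imports Defs
begin

text \<open>A point of the split circle is a position together with a side, and on points of a fixed side
  the rotation is the ordinary rotation of \<open>[0,1)\<close> or \<open>(0,1]\<close>. For \<open>\<theta> < 1/2\<close> the first return map to
  \<open>[0, delta \<theta>)\<close> is, after rescaling, the rotation by \<open>renorm \<theta>\<close>, and the letters met before the
  return spell \<open>sigma \<theta>\<close> of the letter of the rescaled point; for \<open>\<theta> > 1/2\<close> the reflection conjugates
  the rotation by \<open>\<theta>\<close> to that by \<open>1 - \<theta>\<close>. Hence \<open>sigma \<theta>\<close> maps prefixes of the coding of
  \<open>phi \<theta> p\<close> to prefixes of the coding of \<open>p\<close>. All images under a nontrivial substitution begin with
  \<open>A\<close>, and the image of \<open>A\<close> is longer than one letter; therefore the limit words exist and do not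
  depend on the seed. The half-open coding can only differ from the split one when the orbit meets
  \<open>0\<close>, \<open>1/2\<close> or \<open>1 - \<theta>\<close>, which by irrationality happens at most twice.\<close>

section \<open>Continued fractions and the renormalization\<close>

text \<open>The Boolean side and the predicate \<open>above\<close> treat both one-sided versions of
  the circle at once: side \<open>True\<close> stands for intervals closed on the left, side
  \<open>False\<close> for intervals closed on the right, and reflection exchanges them. The
  delicate point is the set of split points: on [0, \<open>delta \<theta>\<close>], rescaling must
  match \<open>split_set \<theta>\<close> exactly with \<open>split_set (renorm \<theta>)\<close>.
  The group generated by 1 and \<theta> rescales correctly by pure algebra, but split points involve
  only backward rotations, and the sign of the index has to be recovered from the bounds on the
  point. Substitutions act on finite words only. Codings at consecutive levels are linked by the
  statement that images of prefixes are prefixes, so every limit claim reduces to growth of lengths.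
  The special point has a unique position because of any two consecutive angles one is below 1/2,
  and there \<open>delta\<close> is below 1/2. Its side is unique because both candidates would have
  the same limit word as coding, whereas the two sides of a split position are told apart when the
  orbit reaches 0 or 1/2.\<close>

locale irrational_angle =
  fixes \<theta> :: real
  assumes pos: "0 < \<theta>" and less_1: "\<theta> < 1" and irrational: "\<theta> \<notin> \<rat>"

lemma gauss_map_irrational_angle:
  assumes "irrational_angle t"
  shows "irrational_angle (gauss_map t)"
proof -
  interpret irrational_angle t by fact
  have 1: "1 / t \<notin> \<rat>"
    using irrational Rats_inverse[of "1/t"] by (auto simp: field_simps)
  have "gauss_map t \<notin> \<rat>"
  proof
    assume "gauss_map t \<in> \<rat>"
    then have "gauss_map t + of_int \<lfloor>1/t\<rfloor> \<in> \<rat>" by simp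
    then show False using 1 by (simp add: gauss_map_def frac_def)
  qed
  moreover from this have "gauss_map t \<noteq> 0" by force
  ultimately show ?thesis
    unfolding irrational_angle_def gauss_map_def
    using frac_ge_0[of "1/t"] frac_lt_1[of "1/t"] by linarith
qed

lemma cf_digit_1: "irrational_angle t \<Longrightarrow> 1 / t = real (cf_digit 1 t) + gauss_map t"
  by (simp add: cf_digit_def gauss_map_def frac_def irrational_angle_def)

lemma cf_digit_1_ge_1:
  assumes "irrational_angle t"
  shows "cf_digit 1 t \<ge> 1"
proof -
  interpret irrational_angle t by fact
  have "1 / t \<ge> 1" using pos less_1 by simp
  then have "\<lfloor>1 / t\<rfloor> \<ge> 1" by linarith
  then show ?thesis unfolding cf_digit_def by simp linarith
qed

lemma cf_digit_Suc: "i \<ge> 1 \<Longrightarrow> cf_digit (Suc i) t = cf_digit i (gauss_map t)"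
  by (cases i) (simp_all add: cf_digit_def funpow_swap1)

lemma cf_digit_2: "cf_digit 2 t = cf_digit 1 (gauss_map t)"
  using cf_digit_Suc[of 1 t] by (simp add: numeral_2_eq_2)

lemma cf_digit_3: "cf_digit 3 t = cf_digit 1 (gauss_map (gauss_map t))"
  using cf_digit_Suc[of 2 t] cf_digit_2[of "gauss_map t"] by (simp add: numeral_3_eq_3)

lemma eq_inverse_cf_digit_1:
  assumes "irrational_angle t"
  shows "t = 1 / (real (cf_digit 1 t) + gauss_map t)"
  using cf_digit_1[OF assms] by (metis divide_divide_eq_right div_by_1 mult_1)

lemma cf_finite_bounds: "0 \<le> cf_finite as"
  by (induction as) auto

text \<open>A single level x -> 1 / (a + x) has slope -1 at a = 1, x = 0 and does not contract
  uniformly. For two levels the difference is x - y divided by a product of two factors that are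
  each at least 2; hence the 4.\<close>

lemma cf_contraction:
  fixes a b x y :: real
  assumes "a \<ge> 1" "b \<ge> 1" "x \<ge> 0" "y \<ge> 0"
  shows "\<bar>1 / (a + 1 / (b + x)) - 1 / (a + 1 / (b + y))\<bar> \<le> \<bar>x - y\<bar> / 4"
proof -
  have *: "1 / (a + 1 / (b + z)) = (b + z) / (a * (b + z) + 1)" if "z \<ge> 0" for z
    using assms that by (simp add: field_simps)
  have ge: "a * (b + z) + 1 \<ge> 2" if "z \<ge> 0" for z
  proof -
    have "1 * 1 \<le> a * (b + z)" using assms that by (intro mult_mono) auto
    then show ?thesis by simp
  qed
  define X Y where "X = a * (b + x) + 1" and "Y = a * (b + y) + 1"
  have XY: "X \<ge> 2" "Y \<ge> 2" using ge assms by (auto simp: X_def Y_def)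
  have "2 * 2 \<le> X * Y" using XY by (intro mult_mono) auto
  then have 4: "4 \<le> X * Y" by simp
  have "(b + x) / X - (b + y) / Y = (x - y) / (X * Y)"
    using XY by (simp add: field_simps) (simp add: X_def Y_def algebra_simps)
  then have "\<bar>(b + x) / X - (b + y) / Y\<bar> = \<bar>x - y\<bar> / (X * Y)"
    using XY by (simp add: abs_mult)
  also have "\<dots> \<le> \<bar>x - y\<bar> / 4"
    using 4 by (intro divide_left_mono) auto
  finally show ?thesis
    using assms by (simp add: * X_def Y_def)
qed

lemma cf_digits_Suc:
  "map (\<lambda>i. cf_digit i t) [1..<Suc (Suc n)] =
     cf_digit 1 t # map (\<lambda>i. cf_digit i (gauss_map t)) [1..<Suc n]"
proof -
  have "[1..<Suc (Suc n)] = 1 # map Suc [1..<Suc n]"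
    by (simp add: map_Suc_upt upt_conv_Cons del: upt_Suc)
  then show ?thesis
    by (auto simp: cf_digit_Suc simp del: upt_Suc)
qed

lemma cf_finite_digits_error:
  "irrational_angle t \<Longrightarrow>
     \<bar>cf_finite (map (\<lambda>i. cf_digit i t) [1..<Suc n]) - t\<bar> \<le> 2 * (1/2) ^ n"
proof (induction n arbitrary: t rule: less_induct)
  case (less n)
  interpret irrational_angle t by fact
  have g1: "irrational_angle (gauss_map t)" using less.prems by (rule gauss_map_irrational_angle)
  interpret g: irrational_angle "gauss_map t" by fact
  have g2: "irrational_angle (gauss_map (gauss_map t))" using g1 by (rule gauss_map_irrational_angle)
  interpret gg: irrational_angle "gauss_map (gauss_map t)" by fact
  have a1: "real (cf_digit 1 t) \<ge> 1" using cf_digit_1_ge_1[OF less.prems] by simp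
  consider "n = 0" | "n = 1" | m where "n = Suc (Suc m)"
    by (metis One_nat_def not0_implies_Suc)
  then show ?case
  proof cases
    case 1
    then show ?thesis using pos less_1 by simp
  next
    case 2
    have "1 / real (cf_digit 1 t) \<le> 1" "0 < 1 / real (cf_digit 1 t)"
      using a1 by (simp_all add: field_simps)
    then have "\<bar>1 / real (cf_digit 1 t) - t\<bar> \<le> 1" using pos less_1 by linarith
    then show ?thesis using 2 by simp
  next
    case (3 m)
    let ?F = "cf_finite (map (\<lambda>i. cf_digit i (gauss_map (gauss_map t))) [1..<Suc m])"
    let ?a = "real (cf_digit 1 t)" and ?b = "real (cf_digit 1 (gauss_map t))"
    have "cf_finite (map (\<lambda>i. cf_digit i t) [1..<Suc n]) = 1 / (?a + 1 / (?b + ?F))"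
      unfolding 3 by (simp only: cf_digits_Suc cf_finite.simps)
    moreover have "t = 1 / (?a + 1 / (?b + gauss_map (gauss_map t)))"
      using eq_inverse_cf_digit_1[OF less.prems] eq_inverse_cf_digit_1[OF g1] by simp
    ultimately have "\<bar>cf_finite (map (\<lambda>i. cf_digit i t) [1..<Suc n]) - t\<bar>
        = \<bar>1 / (?a + 1 / (?b + ?F)) - 1 / (?a + 1 / (?b + gauss_map (gauss_map t)))\<bar>"
      by argo
    also have "\<dots> \<le> \<bar>?F - gauss_map (gauss_map t)\<bar> / 4"
      using a1 cf_digit_1_ge_1[OF g1] gg.pos cf_finite_bounds
      by (intro cf_contraction) auto
    also have "\<dots> \<le> 2 * (1/2) ^ m / 4"
      using less.IH[OF _ g2, of m] 3 by (intro divide_right_mono) auto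
    finally show ?thesis using 3 by simp
  qed
qed

text \<open>\<open>renorm\<close> is defined through limits of finite continued fractions. With this
  lemma it is evaluated by exhibiting a number that has the prescribed digits.\<close>

lemma cf_value_eq:
  assumes "irrational_angle t" and "\<And>i. i \<ge> 1 \<Longrightarrow> a i = cf_digit i t"
  shows "cf_value a = t"
proof -
  let ?F = "\<lambda>n. cf_finite (map (\<lambda>i. cf_digit i t) [1..<Suc n])"
  have "(\<lambda>n. (1/2) ^ n :: real) \<longlonglongrightarrow> 0"
    by (rule LIMSEQ_power_zero) simp
  moreover have "\<forall>\<^sub>F n in sequentially. norm (?F n - t) \<le> norm ((1/2) ^ n :: real) * 2"
    using cf_finite_digits_error[OF assms(1)]
    by (intro always_eventually allI) (simp add: mult.commute del: upt_Suc)
  ultimately have "(\<lambda>n. ?F n - t) \<longlonglongrightarrow> 0"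
    by (rule tendsto_0_le)
  then have "?F \<longlonglongrightarrow> t"
    by (simp add: LIM_zero_iff del: upt_Suc)
  moreover have "map a [1..<Suc n] = map (\<lambda>i. cf_digit i t) [1..<Suc n]" for n
    using assms(2) by (intro map_cong) auto
  ultimately show ?thesis
    unfolding cf_value_def by (simp only: limI)
qed

section \<open>Arithmetic of a single renormalization step\<close>

lemma even_floor_of_nat: "even_floor (real n) = 2 * int (n div 2)"
  unfolding even_floor_def
proof (rule Greatest_equality)
  show "even (2 * int (n div 2)) \<and> real_of_int (2 * int (n div 2)) \<le> real n"
    by simp
next
  fix m :: int
  assume "even m \<and> real_of_int m \<le> real n"
  then have "even m" "m \<le> int n" by linarith+
  then show "m \<le> 2 * int (n div 2)" by presburger
qed

lemma delta_eq: "delta \<theta> = 1 - 2 * real (cf_digit 1 \<theta> div 2) * \<theta>"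
  by (simp add: delta_def even_floor_of_nat)

definition half_digit :: "real \<Rightarrow> nat" where
  "half_digit \<theta> = cf_digit 1 \<theta> div 2"

text \<open>For \<theta> < 1/2 this is the integer part of \<open>\<theta> / delta \<theta>\<close>:
  the quotient is \<open>1 / gauss_map \<theta>\<close> if the first digit is even, and
  \<open>1 / (1 + gauss_map \<theta>)\<close>, which is below 1, if it is odd.\<close>

definition quot_digit :: "real \<Rightarrow> nat" where
  "quot_digit \<theta> = (if even (cf_digit 1 \<theta>) then cf_digit 2 \<theta> else 0)"

context irrational_angle
begin

lemma ne_half: "\<theta> \<noteq> 1/2"
proof
  assume "\<theta> = 1/2"
  moreover have "1/2 \<in> (\<rat> :: real set)" by (intro Rats_divide) auto
  ultimately show False using irrational by blast
qed

lemma cf_digit_1_eq_1_iff: "cf_digit 1 \<theta> = 1 \<longleftrightarrow> \<theta> > 1/2"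
proof -
  have "cf_digit 1 \<theta> = 1 \<longleftrightarrow> \<lfloor>1 / \<theta>\<rfloor> = 1"
    unfolding cf_digit_def using pos by (auto simp: nat_eq_iff)
  also have "\<dots> \<longleftrightarrow> 1 \<le> 1 / \<theta> \<and> 1 / \<theta> < 2"
    by (simp add: floor_eq_iff)
  also have "\<dots> \<longleftrightarrow> \<theta> > 1/2"
    using pos less_1 by (auto simp: field_simps)
  finally show ?thesis .
qed

lemma renorm_gt_half:
  assumes "\<theta> > 1/2"
  shows "renorm \<theta> = 1 - \<theta>"
proof -
  have ia: "irrational_angle \<theta>" by (rule irrational_angle_axioms)
  have g: "irrational_angle (gauss_map \<theta>)" by (rule gauss_map_irrational_angle[OF ia])
  have one: "cf_digit 1 \<theta> = 1" using assms cf_digit_1_eq_1_iff by blast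
  have it: "irrational_angle (1 - \<theta>)"
    using pos less_1 irrational Rats_diff[of 1 "1-\<theta>"] by unfold_locales auto
  have "1 / \<theta> = 1 + gauss_map \<theta>" using cf_digit_1[OF ia] one by simp
  then have "\<theta> = 1 / (1 + gauss_map \<theta>)" using eq_inverse_cf_digit_1[OF ia] one by simp
  moreover have "1 + gauss_map \<theta> > 0" "gauss_map \<theta> > 0" using irrational_angle.pos[OF g] by simp_all
  ultimately have "1 - \<theta> = gauss_map \<theta> / (1 + gauss_map \<theta>)"
    by (simp add: field_simps)
  then have "1 / (1 - \<theta>) = (1 + gauss_map \<theta>) / gauss_map \<theta>"
    by simp
  \<comment> \<open>The reciprocals of \<open>1 - \<theta>\<close> and
    \<open>gauss_map \<theta>\<close> differ by exactly 1: same Gauss image, first digit larger by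
    one.\<close>
  then have inv: "1 / (1 - \<theta>) = 1 + 1 / gauss_map \<theta>"
    using \<open>gauss_map \<theta> > 0\<close> by (simp add: add_divide_distrib)
  then have gt: "gauss_map (1 - \<theta>) = gauss_map (gauss_map \<theta>)"
    by (simp add: gauss_map_def frac_def)
  have "1 / gauss_map \<theta> > 0" using irrational_angle.pos[OF g] by simp
  then have d1: "cf_digit 1 (1 - \<theta>) = cf_digit 1 (gauss_map \<theta>) + 1"
    by (simp add: cf_digit_def inv nat_add_distrib)
  have "(if i = 1 then cf_digit 2 \<theta> + 1 else cf_digit (i + 1) \<theta>) = cf_digit i (1 - \<theta>)"
    if "i \<ge> 1" for i
  proof (cases "i = Suc 0")
    case True
    then show ?thesis using d1 by (simp add: cf_digit_2)
  next
    case False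
    then obtain j where "i = Suc j" "j \<ge> 1"
      using \<open>i \<ge> 1\<close> by (cases i) auto
    then show ?thesis using gt by (simp add: cf_digit_Suc)
  qed
  from cf_value_eq[OF it this] show ?thesis
    using one by (simp add: renorm_def)
qed

lemma cf_digit_1_ge_2:
  assumes "\<theta> < 1/2"
  shows "cf_digit 1 \<theta> \<ge> 2"
  using cf_digit_1_eq_1_iff cf_digit_1_ge_1[OF irrational_angle_axioms] assms by linarith

lemma renorm_even:
  assumes "even (cf_digit 1 \<theta>)"
  shows "renorm \<theta> = gauss_map (gauss_map \<theta>)"
proof -
  have "cf_digit (i + 2) \<theta> = cf_digit i (gauss_map (gauss_map \<theta>))" if "i \<ge> 1" for i
    using that by (simp add: cf_digit_Suc)
  from cf_value_eq[OF _ this] show ?thesis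
    using assms gauss_map_irrational_angle irrational_angle_axioms by (auto simp: renorm_def)
qed

lemma renorm_odd:
  assumes "odd (cf_digit 1 \<theta>)" "cf_digit 1 \<theta> \<noteq> 1"
  shows "renorm \<theta> = 1 / (1 + gauss_map \<theta>)" "irrational_angle (1 / (1 + gauss_map \<theta>))"
proof -
  let ?t = "1 / (1 + gauss_map \<theta>)"
  have "irrational_angle (gauss_map \<theta>)"
    by (rule gauss_map_irrational_angle[OF irrational_angle_axioms])
  then interpret g: irrational_angle "gauss_map \<theta>" .
  have "?t \<notin> \<rat>"
  proof
    assume "?t \<in> \<rat>"
    then have "inverse ?t - 1 \<in> \<rat>" by (intro Rats_diff Rats_inverse) auto
    then show False using g.irrational by simp
  qed
  then show it: "irrational_angle ?t"
    using g.pos g.less_1 by unfold_locales (auto simp: field_simps)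
  have gt: "gauss_map ?t = gauss_map \<theta>"
    using g.pos g.less_1 by (subst gauss_map_def) (simp add: frac_eq frac_unique_iff)
  have "\<lfloor>1 + gauss_map \<theta>\<rfloor> = 1" using g.pos g.less_1 by (simp add: floor_eq_iff)
  then have d1: "cf_digit 1 ?t = 1" by (simp add: cf_digit_def)
  have "(if i = 1 then 1 else cf_digit i \<theta>) = cf_digit i ?t" if "i \<ge> 1" for i
  proof (cases "i = Suc 0")
    case False
    then obtain j where "i = Suc j" "j \<ge> 1"
      using \<open>i \<ge> 1\<close> by (cases i) auto
    then show ?thesis using gt by (simp add: cf_digit_Suc)
  next
    case True
    then show ?thesis using d1 by simp
  qed
  from cf_value_eq[OF it this] show "renorm \<theta> = ?t"
    using assms by (simp add: renorm_def)
qed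

lemma renorm_irrational_angle: "irrational_angle (renorm \<theta>)"
proof (cases "\<theta> > 1/2")
  case True
  have "1 - \<theta> \<notin> \<rat>" using irrational Rats_diff[of 1 "1-\<theta>"] by auto
  then show ?thesis using renorm_gt_half[OF True] pos less_1 by unfold_locales auto
next
  case False
  then have "cf_digit 1 \<theta> \<noteq> 1" using cf_digit_1_eq_1_iff by simp
  then show ?thesis
    using renorm_even renorm_odd gauss_map_irrational_angle irrational_angle_axioms by metis
qed

lemma delta_gt_half: "\<theta> > 1/2 \<Longrightarrow> delta \<theta> = 1"
  using cf_digit_1_eq_1_iff by (simp add: delta_eq)

context
  assumes small: "\<theta> < 1/2"
begin

lemma half_digit_ge_1: "half_digit \<theta> \<ge> 1"
  using cf_digit_1_ge_2[OF small] by (simp add: half_digit_def)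

lemma delta_half_digit: "delta \<theta> = 1 - 2 * real (half_digit \<theta>) * \<theta>"
  by (simp add: delta_eq half_digit_def)

lemma delta_cf:
  "delta \<theta> = \<theta> * (gauss_map \<theta> + (if even (cf_digit 1 \<theta>) then 0 else 1))"
proof -
  have 1: "\<theta> * real (cf_digit 1 \<theta>) + \<theta> * gauss_map \<theta> = 1"
    using cf_digit_1[OF irrational_angle_axioms] pos by (simp add: field_simps)
  show ?thesis
  proof (cases "even (cf_digit 1 \<theta>)")
    case True
    then have "2 * real (cf_digit 1 \<theta> div 2) = real (cf_digit 1 \<theta>)"
      by (metis dvd_mult_div_cancel of_nat_mult of_nat_numeral)
    then show ?thesis using 1 True by (simp add: delta_eq algebra_simps)
  next
    case False
    then have "cf_digit 1 \<theta> = 2 * (cf_digit 1 \<theta> div 2) + 1" by presburger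
    then have "real (cf_digit 1 \<theta>) = 2 * real (cf_digit 1 \<theta> div 2) + 1"
      by (metis of_nat_1 of_nat_add of_nat_mult of_nat_numeral)
    then show ?thesis using 1 False by (simp add: delta_eq algebra_simps)
  qed
qed

lemma delta_pos: "delta \<theta> > 0"
  using delta_cf pos irrational_angle.pos[OF gauss_map_irrational_angle[OF irrational_angle_axioms]]
  by simp

text \<open>In both parities \<open>renorm \<theta>\<close> is the fractional part of
  \<open>\<theta> / delta \<theta>\<close>. Together with 1 = \<open>delta \<theta>\<close> +
  2k\<theta>, where k is \<open>half_digit \<theta>\<close>, this converts between the two
  scales.\<close>

lemma theta_eq: "\<theta> = (real (quot_digit \<theta>) + renorm \<theta>) * delta \<theta>"
proof (cases "even (cf_digit 1 \<theta>)")
  case True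
  have g: "irrational_angle (gauss_map \<theta>)"
    by (rule gauss_map_irrational_angle[OF irrational_angle_axioms])
  have "real (quot_digit \<theta>) + renorm \<theta> = 1 / gauss_map \<theta>"
    using True cf_digit_1[OF g] by (simp add: quot_digit_def renorm_even cf_digit_2)
  then show ?thesis using True irrational_angle.pos[OF g] by (simp add: delta_cf)
next
  case False
  then have "renorm \<theta> = 1 / (1 + gauss_map \<theta>)"
    using renorm_odd cf_digit_1_ge_2[OF small] by force
  then show ?thesis
    using False irrational_angle.pos[OF gauss_map_irrational_angle[OF irrational_angle_axioms]]
    by (simp add: delta_cf quot_digit_def add.commute)
qed

lemma delta_less: "delta \<theta> < 2 * \<theta>"
  using delta_cf irrational_angle.less_1[OF gauss_map_irrational_angle[OF irrational_angle_axioms]]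
    pos by (auto simp: mult_less_cancel_left_pos mult.commute[of 2])

text \<open>Add \<open>delta \<theta> \<le> 1 - 2 * \<theta>\<close> and
  \<open>delta \<theta> < 2 * \<theta>\<close>. The bound is the contraction factor of the nested
  intervals around the special point.\<close>

lemma delta_less_half: "delta \<theta> < 1/2"
proof -
  have "delta \<theta> \<le> 1 - 2 * 1 * \<theta>"
    unfolding delta_half_digit using half_digit_ge_1 pos by (simp add: mult_right_mono)
  then show ?thesis using delta_less by linarith
qed

text \<open>Here \<theta> = \<open>renorm \<theta> * delta \<theta>\<close>, while
  \<open>delta \<theta>\<close> is less than 2\<theta>. Read backwards:
  \<open>renorm \<theta> < 1/2\<close> forces a positive \<open>quot_digit\<close>, so the exponent
  a - 1 in the image of \<open>B\<close> is a true subtraction.\<close>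

lemma quot_digit_0:
  assumes "quot_digit \<theta> = 0"
  shows "renorm \<theta> > 1/2"
proof -
  have "delta \<theta> * (1/2) < delta \<theta> * renorm \<theta>"
    using theta_eq delta_less assms by (simp add: mult.commute)
  then show ?thesis using delta_pos mult_less_cancel_left_pos by blast
qed

end

end

section \<open>The first return map\<close>

lemma word_power_simps [simp]:
  "word_power w 0 = []"
  "word_power w (Suc n) = w @ word_power w n"
  by (simp_all add: word_power_def)

lemma length_word_power [simp]: "length (word_power w n) = n * length w"
  by (induction n) simp_all

definition block_Q :: "nat \<Rightarrow> letter list" where
  "block_Q k = word_power [A] k @ word_power [B] (k - 1) @ [C]"

definition block_S :: "nat \<Rightarrow> letter list" where
  "block_S k = word_power [A] k @ word_power [B] k @ [C]"

text \<open>All cases of \<open>sigma\<close> with \<open>\<theta> < 1/2\<close> are covered by one formula, since the block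
  \<open>A\<^sup>k\<^sup>+\<^sup>1B\<^sup>k\<^sup>-\<^sup>1C\<close> is \<open>A\<close> followed by \<open>block_Q k\<close>; odd \<open>a\<^sub>1\<close> behaves like even \<open>a\<^sub>1\<close> with
  \<open>a\<^sub>2 = 0\<close>.\<close>

lemma (in irrational_angle) sigma_eq:
  assumes "\<theta> < 1/2"
  shows "sigma \<theta> l =
    (let k = half_digit \<theta>; a = quot_digit \<theta> in
     if renorm \<theta> < 1/2
     then (case l of A \<Rightarrow> A # word_power (block_Q k) a
                   | B \<Rightarrow> block_S k @ word_power (block_Q k) (a - 1)
                   | C \<Rightarrow> block_S k @ word_power (block_Q k) a)
     else (case l of A \<Rightarrow> block_S k @ word_power (block_Q k) a
                   | B \<Rightarrow> A # word_power (block_Q k) (a + 1)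
                   | C \<Rightarrow> A # word_power (block_Q k) a))"
proof (cases "even (cf_digit 1 \<theta>)")
  case True
  let ?g = "gauss_map (gauss_map \<theta>)"
  have g: "irrational_angle ?g" "irrational_angle (gauss_map \<theta>)"
    using gauss_map_irrational_angle irrational_angle_axioms by blast+
  have a3: "cf_digit 3 \<theta> = 1 \<longleftrightarrow> \<not> renorm \<theta> < 1/2"
    using irrational_angle.cf_digit_1_eq_1_iff[OF g(1)] irrational_angle.ne_half[OF g(1)]
    by (auto simp: renorm_even[OF True] cf_digit_3)
  have "cf_digit 2 \<theta> \<ge> 1" using cf_digit_1_ge_1[OF g(2)] by (simp add: cf_digit_2)
  then obtain b where "cf_digit 2 \<theta> = Suc b" by (metis Suc_le_D One_nat_def)
  then show ?thesis
    using True a3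
    by (cases l) (simp_all add: sigma_def half_digit_def quot_digit_def block_Q_def block_S_def Let_def)
next
  case False
  have "renorm \<theta> > 1/2" using False assms by (intro quot_digit_0) (simp_all add: quot_digit_def)
  moreover have "cf_digit 1 \<theta> \<noteq> 1" using cf_digit_1_ge_2[OF assms] by simp
  ultimately show ?thesis
    using False
    by (cases l) (simp_all add: sigma_def half_digit_def quot_digit_def block_Q_def block_S_def Let_def)
qed

lemma (in irrational_angle) sigma_gt_half: "\<theta> > 1/2 \<Longrightarrow> sigma \<theta> l = [l]"
  using cf_digit_1_eq_1_iff by (simp add: sigma_def)

lemma (in irrational_angle) sigma_starts_with_A:
  assumes "\<theta> < 1/2"
  obtains r where "sigma \<theta> l = A # r"
proof -
  obtain k where "half_digit \<theta> = Suc k"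
    using half_digit_ge_1[OF assms] by (metis Suc_le_D One_nat_def)
  then show ?thesis
    using that
    by (cases l; cases "renorm \<theta> < 1/2") (auto simp: sigma_eq[OF assms] block_S_def Let_def)
qed

text \<open>Growth of the words has to come from \<open>A\<close>, since \<open>C\<close> is sent to
  the single letter \<open>A\<close> when the first digit is odd. If the image is \<open>A\<close>
  followed by powers of \<open>block_Q\<close>, then \<open>quot_digit\<close> is positive;
  otherwise the image contains \<open>block_S\<close>.\<close>

lemma (in irrational_angle) sigma_A_starts_with_A:
  assumes "\<theta> < 1/2"
  obtains r where "sigma \<theta> A = A # r" "r \<noteq> []"
proof -
  obtain k where k: "half_digit \<theta> = Suc k"
    using half_digit_ge_1[OF assms] by (metis Suc_le_D One_nat_def)
  show ?thesis
  proof (cases "renorm \<theta> < 1/2")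
    case True
    then have "quot_digit \<theta> \<noteq> 0" using quot_digit_0[OF assms] by auto
    then obtain a where "quot_digit \<theta> = Suc a" by (cases "quot_digit \<theta>") auto
    then show ?thesis
      using that True k by (auto simp: sigma_eq[OF assms] block_Q_def Let_def)
  next
    case False
    then show ?thesis
      using that k by (auto simp: sigma_eq[OF assms] block_S_def Let_def)
  qed
qed

text \<open>The point on side s at position x lies to the right of the cut at c: at x = c the plus
  point does, the minus point does not.\<close>

definition above :: "bool \<Rightarrow> real \<Rightarrow> real \<Rightarrow> bool" where
  "above s c x \<longleftrightarrow> (if s then c \<le> x else c < x)"

lemma above_mono: "above s c x \<Longrightarrow> c' \<le> c \<Longrightarrow> above s c' x"
  by (auto simp: above_def split: if_splits)

lemma not_above_mono: "\<not> above s c x \<Longrightarrow> c \<le> c' \<Longrightarrow> \<not> above s c' x"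
  by (auto simp: above_def split: if_splits)

lemma above_plus: "above s c (x + t) \<longleftrightarrow> above s (c - t) x"
  and above_minus: "above s c (x - t) \<longleftrightarrow> above s (c + t) x"
  and above_one_minus: "above (\<not> s) c (1 - x) \<longleftrightarrow> \<not> above s (1 - c) x"
  by (auto simp: above_def)

lemma above_divide: "d > 0 \<Longrightarrow> above s c (x / d) \<longleftrightarrow> above s (c * d) x"
  by (auto simp: above_def field_simps)

definition turn :: "real \<Rightarrow> bool \<Rightarrow> real \<Rightarrow> real" where
  "turn \<theta> s x = (if above s 1 (x + \<theta>) then x + \<theta> - 1 else x + \<theta>)"

definition letter_at :: "real \<Rightarrow> bool \<Rightarrow> real \<Rightarrow> letter" where
  "letter_at \<theta> s x =
     (if \<theta> < 1/2
      then (if \<not> above s (1/2) x then A else if \<not> above s (1-\<theta>) x then B else C)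
      else (if \<not> above s (1-\<theta>) x then C else if \<not> above s (1/2) x then B else A))"

text \<open>The end position is recorded along with the letters, so that itineraries of blocks can
  be chained.\<close>

fun trace :: "real \<Rightarrow> bool \<Rightarrow> real \<Rightarrow> letter list \<Rightarrow> real \<Rightarrow> bool" where
  "trace \<theta> s x [] y \<longleftrightarrow> x = y"
| "trace \<theta> s x (l # w) y \<longleftrightarrow> letter_at \<theta> s x = l \<and> trace \<theta> s (turn \<theta> s x) w y"

lemma trace_append: "trace \<theta> s x u y \<Longrightarrow> trace \<theta> s y v z \<Longrightarrow> trace \<theta> s x (u @ v) z"
  by (induction u arbitrary: x) auto

context irrational_angle
begin

context
  assumes small: "\<theta> < 1/2"
begin

lemma trace_A_power:
  "\<not> above s (1/2 + \<theta> - real n * \<theta>) x \<Longrightarrow> trace \<theta> s x (word_power [A] n) (x + real n * \<theta>)"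
proof (induction n arbitrary: x)
  case (Suc n)
  have half: "\<not> above s (1/2) x"
    using Suc.prems by (rule not_above_mono) (use pos in \<open>simp add: algebra_simps\<close>)
  then have "\<not> above s (1 - \<theta>) x" by (rule not_above_mono) (use small in simp)
  then have t: "turn \<theta> s x = x + \<theta>" by (simp add: turn_def above_plus)
  have "\<not> above s (1/2 + \<theta> - real n * \<theta>) (x + \<theta>)"
    using Suc.prems unfolding above_plus by (simp add: algebra_simps)
  from Suc.IH[OF this] show ?case
    using half small t by (simp add: letter_at_def algebra_simps)
qed simp

lemma trace_B_power:
  "above s (1/2) x \<Longrightarrow> \<not> above s (1 - real n * \<theta>) x \<Longrightarrow>
     trace \<theta> s x (word_power [B] n) (x + real n * \<theta>)"
proof (induction n arbitrary: x)
  case (Suc n)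
  have le: "\<not> above s (1 - \<theta>) x"
    using Suc.prems(2) by (rule not_above_mono) (use pos in \<open>simp add: algebra_simps\<close>)
  then have t: "turn \<theta> s x = x + \<theta>" by (simp add: turn_def above_plus)
  have 1: "above s (1/2) (x + \<theta>)"
    using Suc.prems(1) unfolding above_plus by (rule above_mono) (use pos in simp)
  have 2: "\<not> above s (1 - real n * \<theta>) (x + \<theta>)"
    using Suc.prems unfolding above_plus by (simp add: algebra_simps)
  from Suc.IH[OF 1 2] show ?case
    using le small Suc.prems(1) t by (simp add: letter_at_def algebra_simps)
qed simp

lemma trace_C:
  assumes "above s (1 - \<theta>) x"
  shows "trace \<theta> s x [C] (x + \<theta> - 1)"
proof -
  have "above s (1/2) x" using assms by (rule above_mono) (use small in simp)
  then show ?thesis using assms small by (simp add: letter_at_def turn_def above_plus)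
qed

lemma two_half_digit: "2 * (real (half_digit \<theta>) * \<theta>) = 1 - delta \<theta>"
  using delta_half_digit[OF small] by simp

text \<open>The block takes 2k rotations with one wrap around the circle, a net move of 2k\<theta> -
  1 = -\<open>delta \<theta>\<close>. The lower bound makes the last point lie in \<open>C\<close>;
  the upper bound keeps the last of the k letters \<open>A\<close> below 1/2.\<close>

lemma trace_block_Q:
  assumes "above s (delta \<theta>) y" "\<not> above s (\<theta> + delta \<theta> / 2) y"
  shows "trace \<theta> s y (block_Q (half_digit \<theta>)) (y - delta \<theta>)"
proof -
  let ?k = "real (half_digit \<theta>)"
  have k: "real (half_digit \<theta> - 1) = ?k - 1"
    using half_digit_ge_1[OF small] by simp
  have d: "delta \<theta> > 0" by (rule delta_pos[OF small])
  have 1: "trace \<theta> s y (word_power [A] (half_digit \<theta>)) (y + ?k * \<theta>)"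
    using assms(2) by (intro trace_A_power) (erule not_above_mono, use two_half_digit in simp)
  have "above s (1/2) (y + ?k * \<theta>)"
    unfolding above_plus using assms(1) by (rule above_mono) (use two_half_digit d in simp)
  moreover have "\<not> above s (1 - (?k - 1) * \<theta>) (y + ?k * \<theta>)"
    unfolding above_plus using assms(2)
    by (rule not_above_mono) (use two_half_digit d in \<open>simp add: algebra_simps\<close>)
  ultimately have 2: "trace \<theta> s (y + ?k * \<theta>) (word_power [B] (half_digit \<theta> - 1))
      (y + ?k * \<theta> + (?k - 1) * \<theta>)"
    using trace_B_power[of s "y + ?k * \<theta>" "half_digit \<theta> - 1"] k by simp
  have "above s (1 - \<theta>) (y + ?k * \<theta> + (?k - 1) * \<theta>)"
    unfolding above_plus using assms(1)
    by (rule above_mono) (use two_half_digit in \<open>simp add: algebra_simps\<close>)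
  from trace_C[OF this] have 3: "trace \<theta> s (y + ?k * \<theta> + (?k - 1) * \<theta>) [C] (y - delta \<theta>)"
    using two_half_digit by (simp add: algebra_simps)
  show ?thesis
    unfolding block_Q_def by (rule trace_append[OF 1 trace_append[OF 2 3]])
qed

text \<open>One rotation more than in \<open>block_Q\<close>, hence a net move of \<theta> -
  \<open>delta \<theta>\<close>. The lower bound puts the point past 1/2 after k steps, the upper
  bound leaves room for k letters \<open>B\<close>, and \<open>delta \<theta> < 2 * \<theta>\<close>
  takes care of the remaining conditions.\<close>

lemma trace_block_S:
  assumes "above s (delta \<theta> / 2) x" "\<not> above s (delta \<theta>) x"
  shows "trace \<theta> s x (block_S (half_digit \<theta>)) (x + \<theta> - delta \<theta>)"
proof -
  let ?k = "real (half_digit \<theta>)"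
  have d: "delta \<theta> < 2 * \<theta>" by (rule delta_less[OF small])
  have 1: "trace \<theta> s x (word_power [A] (half_digit \<theta>)) (x + ?k * \<theta>)"
    using assms(2) by (intro trace_A_power) (erule not_above_mono, use two_half_digit d in simp)
  have "above s (1/2) (x + ?k * \<theta>)"
    unfolding above_plus using assms(1) by (rule above_mono) (use two_half_digit in simp)
  moreover have "\<not> above s (1 - ?k * \<theta>) (x + ?k * \<theta>)"
    unfolding above_plus using assms(2)
    by (rule not_above_mono) (use two_half_digit in \<open>simp add: algebra_simps\<close>)
  ultimately have 2: "trace \<theta> s (x + ?k * \<theta>) (word_power [B] (half_digit \<theta>))
      (x + ?k * \<theta> + ?k * \<theta>)"
    by (rule trace_B_power)
  have "above s (1 - \<theta>) (x + ?k * \<theta> + ?k * \<theta>)"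
    unfolding above_plus using assms(1)
    by (rule above_mono) (use two_half_digit d in \<open>simp add: algebra_simps\<close>)
  from trace_C[OF this] have 3: "trace \<theta> s (x + ?k * \<theta> + ?k * \<theta>) [C] (x + \<theta> - delta \<theta>)"
    using two_half_digit by (simp add: algebra_simps)
  show ?thesis
    unfolding block_S_def by (rule trace_append[OF 1 trace_append[OF 2 3]])
qed

lemma trace_A:
  assumes "\<not> above s (delta \<theta>) x"
  shows "trace \<theta> s x [A] (x + \<theta>)"
proof -
  have "\<not> above s (1/2) x"
    using assms by (rule not_above_mono) (use delta_less_half[OF small] in simp)
  then show ?thesis using trace_A_power[of s 1 x] by simp
qed

lemma trace_block_Q_power:
  "above s (real n * delta \<theta>) y \<Longrightarrow> \<not> above s (\<theta> + delta \<theta> / 2) y \<Longrightarrow>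
     trace \<theta> s y (word_power (block_Q (half_digit \<theta>)) n) (y - real n * delta \<theta>)"
proof (induction n arbitrary: y)
  case (Suc n)
  have d: "delta \<theta> > 0" by (rule delta_pos[OF small])
  have "above s (delta \<theta>) y"
    using Suc.prems(1) by (rule above_mono) (use d in \<open>simp add: algebra_simps\<close>)
  then have 1: "trace \<theta> s y (block_Q (half_digit \<theta>)) (y - delta \<theta>)"
    using Suc.prems(2) by (rule trace_block_Q)
  have "above s (real n * delta \<theta>) (y - delta \<theta>)"
    using Suc.prems(1) by (simp add: above_minus algebra_simps)
  moreover have "\<not> above s (\<theta> + delta \<theta> / 2) (y - delta \<theta>)"
    unfolding above_minus using Suc.prems(2) by (rule not_above_mono) (use d in simp)
  ultimately have 2: "trace \<theta> s (y - delta \<theta>) (word_power (block_Q (half_digit \<theta>)) n)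
      (y - delta \<theta> - real n * delta \<theta>)"
    by (rule Suc.IH)
  show ?case using trace_append[OF 1 2] by (simp add: algebra_simps)
qed simp

lemma trace_A_block_Q_power:
  assumes "\<not> above s (delta \<theta> / 2) x" "above s (real n * delta \<theta> - \<theta>) x"
  shows "trace \<theta> s x (A # word_power (block_Q (half_digit \<theta>)) n) (x + \<theta> - real n * delta \<theta>)"
proof -
  have 1: "trace \<theta> s x [A] (x + \<theta>)"
    using assms(1) by (intro trace_A) (erule not_above_mono, use delta_pos[OF small] in simp)
  have "trace \<theta> s (x + \<theta>) (word_power (block_Q (half_digit \<theta>)) n) (x + \<theta> - real n * delta \<theta>)"
    using assms by (intro trace_block_Q_power) (simp_all add: above_plus)
  from trace_append[OF 1 this] show ?thesis by simp
qed

lemma trace_block_S_block_Q_power: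
  assumes "above s (delta \<theta> / 2) x" "\<not> above s (delta \<theta>) x"
    and "above s (real (n + 1) * delta \<theta> - \<theta>) x"
  shows "trace \<theta> s x (block_S (half_digit \<theta>) @ word_power (block_Q (half_digit \<theta>)) n)
           (x + \<theta> - real (n + 1) * delta \<theta>)"
proof -
  have 1: "trace \<theta> s x (block_S (half_digit \<theta>)) (x + \<theta> - delta \<theta>)"
    using assms by (intro trace_block_S)
  have "above s (real n * delta \<theta>) (x + \<theta> - delta \<theta>)"
    using assms(3) unfolding above_plus above_minus by (simp add: algebra_simps)
  moreover have "\<not> above s (\<theta> + delta \<theta> / 2) (x + \<theta> - delta \<theta>)"
    unfolding above_plus above_minus using assms(2)
    by (rule not_above_mono) (use delta_pos[OF small] in simp)
  ultimately have 2: "trace \<theta> s (x + \<theta> - delta \<theta>) (word_power (block_Q (half_digit \<theta>)) n)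
     (x + \<theta> - delta \<theta> - real n * delta \<theta>)"
    by (rule trace_block_Q_power)
  from trace_append[OF 1 2] show ?thesis by (simp add: algebra_simps)
qed

text \<open>\<open>R\<^sub>\<theta>\<close> induces on \<open>[0, delta \<theta>)\<close> the rotation by \<open>renorm \<theta> * delta \<theta>\<close>: a point \<open>x\<close> moves to
  \<open>x + \<theta>\<close> and then down by steps of \<open>delta \<theta>\<close>, each taking \<open>2k\<close> iterations.\<close>

lemma trace_sigma:
  assumes "above s 0 x" "\<not> above s (delta \<theta>) x"
  shows "trace \<theta> s x (sigma \<theta> (letter_at (renorm \<theta>) s (x / delta \<theta>)))
           (delta \<theta> * turn (renorm \<theta>) s (x / delta \<theta>))"
proof -
  define d \<theta>' a where "d = delta \<theta>" and "\<theta>' = renorm \<theta>" and "a = quot_digit \<theta>"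
  have d: "d > 0" "d < 2 * \<theta>"
    unfolding d_def by (rule delta_pos[OF small] delta_less[OF small])+
  interpret r: irrational_angle \<theta>' unfolding \<theta>'_def by (rule renorm_irrational_angle)
  have \<theta>: "\<theta> = real a * d + \<theta>' * d"
    using theta_eq[OF small] by (simp add: d_def \<theta>'_def a_def algebra_simps)
  have td: "0 < \<theta>' * d" "\<theta>' * d < d" using d r.pos r.less_1 by simp_all
  have half: "above s (1/2) (x / d) \<longleftrightarrow> above s (d / 2) x"
    and one: "above s (1 - \<theta>') (x / d) \<longleftrightarrow> above s (d - \<theta>' * d) x"
    using d by (simp_all add: above_divide algebra_simps)
  have turn: "d * turn \<theta>' s (x / d)
      = (if above s (d - \<theta>' * d) x then x + \<theta>' * d - d else x + \<theta>' * d)"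
    unfolding turn_def above_plus one using d by (simp add: algebra_simps)
  have Suc_a: "real (a + 1) * d = real a * d + d" by (simp add: algebra_simps)
  \<comment> \<open>From x + \<theta> = x + \<theta>'d + a d, always a steps of size d can be
    removed. One more fits exactly when x + \<theta>'d is past d, which is when the rescaled
    rotation wraps.\<close>
  have low: "above s (real a * d - \<theta>) x"
    using assms(1) by (rule above_mono) (use \<theta> td in linarith)
  have high: "above s (real (a + 1) * d - \<theta>) x" if "above s (d - \<theta>' * d) x"
    using that by (rule above_mono) (use \<theta> Suc_a in linarith)
  have end_low: "x + \<theta> - real a * d = x + \<theta>' * d" using \<theta> by linarith
  have end_high: "x + \<theta> - real (a + 1) * d = x + \<theta>' * d - d" using \<theta> Suc_a by linarith
  have AQ: "trace \<theta> s x (A # word_power (block_Q (half_digit \<theta>)) n) (x + \<theta> - real n * d)"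
    if "\<not> above s (d / 2) x" "above s (real n * d - \<theta>) x" for n
    using trace_A_block_Q_power[of s x n] that by (simp add: d_def)
  have SQ: "trace \<theta> s x (block_S (half_digit \<theta>) @ word_power (block_Q (half_digit \<theta>)) n)
           (x + \<theta> - real (n + 1) * d)"
    if "above s (d / 2) x" "above s (real (n + 1) * d - \<theta>) x" for n
    using trace_block_S_block_Q_power[of s x n] that assms(2) by (simp add: d_def)
  note sg = sigma_eq[OF small, folded \<theta>'_def a_def, unfolded Let_def]
  have "trace \<theta> s x (sigma \<theta> (letter_at \<theta>' s (x / d))) (d * turn \<theta>' s (x / d))"
  proof (cases "\<theta>' < 1/2")
    case True
    \<comment> \<open>In case \<open>B\<close> the block \<open>block_S\<close> already accounts for
      one of the a steps, which leaves a - 1 copies of \<open>block_Q\<close>.\<close>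
    then have "a \<noteq> 0" using quot_digit_0[OF small] by (auto simp: a_def \<theta>'_def)
    have le: "d / 2 \<le> d - \<theta>' * d" using mult_right_mono[of \<theta>' "1/2" d] True d(1) by simp
    consider (A) "\<not> above s (d / 2) x" "\<not> above s (d - \<theta>' * d) x"
      | (B) "above s (d / 2) x" "\<not> above s (d - \<theta>' * d) x"
      | (C) "above s (d / 2) x" "above s (d - \<theta>' * d) x"
      using above_mono le by blast
    then show ?thesis
    proof cases
      case A
      then show ?thesis
        using AQ[OF _ low] True by (simp add: letter_at_def half one sg turn end_low)
    next
      case B
      then show ?thesis
        using SQ[of "a - 1"] low True \<open>a \<noteq> 0\<close> by (simp add: letter_at_def half one sg turn end_low)
    next
      case C
      then show ?thesis
        using SQ[OF _ high, unfolded end_high] True by (simp add: letter_at_def half one sg turn)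
    qed
  next
    case False
    have le: "d - \<theta>' * d \<le> d / 2" using mult_right_mono[of "1/2" \<theta>' d] False d(1) by simp
    consider (C) "\<not> above s (d / 2) x" "\<not> above s (d - \<theta>' * d) x"
      | (B) "\<not> above s (d / 2) x" "above s (d - \<theta>' * d) x"
      | (A) "above s (d / 2) x" "above s (d - \<theta>' * d) x"
      using above_mono le by blast
    then show ?thesis
    proof cases
      case A
      then show ?thesis
        using SQ[OF _ high, unfolded end_high] False by (simp add: letter_at_def half one sg turn)
    next
      case B
      then show ?thesis
        using AQ[OF _ high, unfolded end_high] False by (simp add: letter_at_def half one sg turn)
    next
      case C
      then show ?thesis
        using AQ[OF _ low] False by (simp add: letter_at_def half one sg turn end_low)
    qed
  qed
  then show ?thesis by (simp add: d_def \<theta>'_def)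
qed

end

lemma letter_at_reflect:
  assumes "\<theta> > 1/2"
  shows "letter_at (1 - \<theta>) (\<not> s) (1 - x) = letter_at \<theta> s x"
  using assms above_mono[of s "1/2" x "1 - \<theta>"] by (auto simp: letter_at_def above_one_minus)

text \<open>Exactly one of the two rotations wraps. At x + \<theta> = 1 this holds only because the
  side is flipped too.\<close>

lemma turn_reflect: "turn (1 - \<theta>) (\<not> s) (1 - x) = 1 - turn \<theta> s x"
proof -
  have "above (\<not> s) 1 (1 - x + (1 - \<theta>)) \<longleftrightarrow> \<not> above s 1 (x + \<theta>)"
    by (auto simp: above_def)
  then show ?thesis by (simp add: turn_def)
qed

end

section \<open>Coding in the split circle\<close>

text \<open>Positions in [0,1) on the plus side and in (0,1] on the minus side; the left limit at 0
  has position 1.\<close>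

definition on_circle :: "bool \<Rightarrow> real \<Rightarrow> bool" where
  "on_circle s x \<longleftrightarrow> above s 0 x \<and> \<not> above s 1 x"

text \<open>A point of the split circle is represented by a side \<open>s\<close> (\<open>True\<close> for \<open>+\<close>) and a position;
  points that are not split have both sides. Along an orbit the side stays the same.\<close>

definition pt :: "real \<Rightarrow> bool \<Rightarrow> real \<Rightarrow> split_point" where
  "pt \<theta> s x = (if frac x \<in> split_set \<theta> then (if s then PtP x else PtM x) else Pt x)"

lemma position_pt [simp]: "position (pt \<theta> s x) = x"
  by (simp add: pt_def)

lemma frac_eq_frac_iff: "frac (x :: real) = frac y \<longleftrightarrow> (\<exists>m :: int. x = of_int m + y)"
proof
  assume "frac x = frac y"
  then have "x = of_int (\<lfloor>x\<rfloor> - \<lfloor>y\<rfloor>) + y" by (simp add: frac_def)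
  then show "\<exists>m :: int. x = of_int m + y" ..
qed (auto simp: frac_def)

lemma in_split_set_iff:
  "frac x \<in> split_set \<theta> \<longleftrightarrow>
     (\<exists>(m::int) (i::nat). x = of_int m - real i * \<theta> \<or> x = of_int m + 1/2 - real i * \<theta>)"
  by (simp add: split_set_def frac_eq_frac_iff) (simp add: algebra_simps; blast)

lemma split_setI:
  "x = of_int m - real i * \<theta> \<Longrightarrow> frac x \<in> split_set \<theta>"
  "x = of_int m + 1/2 - real i * \<theta> \<Longrightarrow> frac x \<in> split_set \<theta>"
  unfolding in_split_set_iff by blast+

lemma split_set_endpoints [simp]:
  "0 \<in> split_set \<theta>" "1/2 \<in> split_set \<theta>" "frac (1 - \<theta>) \<in> split_set \<theta>"
  using split_setI(1)[of 0 0 0 \<theta>] split_setI(2)[of "1/2" 0 0 \<theta>] split_setI(1)[of "1-\<theta>" 1 1 \<theta>]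
  by simp_all

lemma split_set_delta [simp]: "frac (delta \<theta>) \<in> split_set \<theta>"
  by (rule split_setI(1)[of _ 1 "2 * (cf_digit 1 \<theta> div 2)"]) (simp add: delta_eq)

text \<open>Split points form backward orbits. A rotation can therefore merge the two sides of a
  position but never has to choose a side for an unsplit point.\<close>

lemma split_set_diff:
  assumes "frac (x + \<theta>) \<in> split_set \<theta>"
  shows "frac x \<in> split_set \<theta>"
proof -
  obtain m :: int and i :: nat
    where "x + \<theta> = of_int m - real i * \<theta> \<or> x + \<theta> = of_int m + 1/2 - real i * \<theta>"
    using assms unfolding in_split_set_iff by blast
  then have "x = of_int m - real (Suc i) * \<theta> \<or> x = of_int m + 1/2 - real (Suc i) * \<theta>"
    by (auto simp: algebra_simps)
  then show ?thesis unfolding in_split_set_iff by blast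
qed

lemma split_set_reflect_imp:
  assumes "frac x \<in> split_set \<theta>"
  shows "frac (1 - x) \<in> split_set (1 - \<theta>)"
proof -
  obtain m :: int and i :: nat
    where "x = of_int m - real i * \<theta> \<or> x = of_int m + 1/2 - real i * \<theta>"
    using assms unfolding in_split_set_iff by blast
  then have "1 - x = of_int (1 - m + int i) - real i * (1 - \<theta>) \<or>
      1 - x = of_int (int i - m) + 1/2 - real i * (1 - \<theta>)"
    by (auto simp: algebra_simps)
  then show ?thesis unfolding in_split_set_iff by blast
qed

lemma split_set_reflect: "frac (1 - x) \<in> split_set (1 - \<theta>) \<longleftrightarrow> frac x \<in> split_set \<theta>"
  using split_set_reflect_imp[of x \<theta>] split_set_reflect_imp[of "1 - x" "1 - \<theta>"] by auto

text \<open>At x = c the point is a genuine one-sided point because c is split, so the order of the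
  split circle decides exactly as \<open>above\<close> does.\<close>

lemma split_le_pt_iff:
  assumes "frac c \<in> split_set \<theta>"
  shows "split_le (PtP c) (pt \<theta> s x) \<longleftrightarrow> above s c x"
    and "split_le (pt \<theta> s x) (PtM c) \<longleftrightarrow> \<not> above s c x"
  using assms by (cases "x = c"; cases s; auto simp: split_le_def pt_def above_def)+

lemma pt_in_split_circle:
  assumes "on_circle s x"
  shows "pt \<theta> s x \<in> split_circle \<theta>"
proof (cases "frac x \<in> split_set \<theta> \<and> \<not> s \<and> x = 1")
  case True
  then have "pt \<theta> s x \<in> lifts \<theta> 0" by (simp add: pt_def lifts_def minus_pt_def)
  then show ?thesis by (force simp: split_circle_def)
next
  case no: False
  show ?thesis
  proof (cases "x < 1")
    case True
    then have "x \<in> {0..<1}" using assms by (auto simp: on_circle_def above_def split: if_splits)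
    moreover from this have "pt \<theta> s x \<in> lifts \<theta> x"
      using assms by (cases s) (auto simp: pt_def lifts_def minus_pt_def on_circle_def above_def frac_eq)
    ultimately show ?thesis by (auto simp: split_circle_def)
  next
    case False
    then have "x = 1" "\<not> s" using assms by (auto simp: on_circle_def above_def split: if_splits)
    then show ?thesis using no by simp
  qed
qed

lemma lifts_cases:
  assumes "p \<in> lifts \<theta> y" "0 \<le> y" "y < 1"
  obtains (plus) "p = pt \<theta> True y" "on_circle True y"
    | (minus) "p = pt \<theta> False y" "on_circle False y" "y > 0" "y \<in> split_set \<theta>"
    | (one) "p = pt \<theta> False 1" "on_circle False 1" "y = 0"
proof -
  have y: "frac y = y" using assms by (simp add: frac_eq)
  have "p = pt \<theta> True y \<or> (p = pt \<theta> False y \<and> y > 0 \<and> y \<in> split_set \<theta>)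
      \<or> (p = pt \<theta> False 1 \<and> y = 0)"
    using assms y by (auto simp: lifts_def pt_def minus_pt_def split: if_splits)
  then show ?thesis using that assms by (auto simp: on_circle_def above_def)
qed

lemma split_circle_cases:
  assumes "p \<in> split_circle \<theta>"
  obtains s x where "p = pt \<theta> s x" "on_circle s x"
  using assms lifts_cases unfolding split_circle_def
  by (metis UN_E atLeastLessThan_iff)

lemma pt_in_split_interval:
  assumes "on_circle s x" "frac c \<in> split_set \<theta>" "frac d \<in> split_set \<theta>"
  shows "pt \<theta> s x \<in> split_interval \<theta> (PtP c) (PtM d) \<longleftrightarrow> above s c x \<and> \<not> above s d x"
  using assms by (simp add: split_interval_def pt_in_split_circle split_le_pt_iff)

lemma pt_in_sub_circle:
  assumes "on_circle s x"
  shows "pt \<theta> s x \<in> sub_circle \<theta> \<longleftrightarrow> \<not> above s (delta \<theta>) x"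
  using assms by (simp add: sub_circle_def pt_in_split_interval) (simp add: on_circle_def)

lemma sub_circle_subset: "sub_circle \<theta> \<subseteq> split_circle \<theta>"
  by (auto simp: sub_circle_def split_interval_def)

definition code :: "real \<Rightarrow> split_point \<Rightarrow> letter word" where
  "code \<theta> p i = (THE l. (rot \<theta> ^^ i) p \<in> split_part \<theta> l)"

lemma orbit_word_eq: "orbit_word \<theta> p j = map (code \<theta> p) [0..<j]"
  by (simp add: orbit_word_def code_def)

lemma trace_iff:
  "trace \<theta> s x w y \<longleftrightarrow>
     (\<forall>i<length w. letter_at \<theta> s ((turn \<theta> s ^^ i) x) = w ! i) \<and> (turn \<theta> s ^^ length w) x = y"
proof (induction w arbitrary: x)
  case (Cons l w)
  show ?case
    by (simp add: Cons All_less_Suc2 funpow_swap1)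
qed simp

context irrational_angle
begin

lemma pt_in_split_part:
  assumes "on_circle s x"
  shows "pt \<theta> s x \<in> split_part \<theta> l \<longleftrightarrow> l = letter_at \<theta> s x"
proof -
  note [simp] = pt_in_split_interval[OF assms]
  have x: "above s 0 x" "\<not> above s 1 x" using assms by (auto simp: on_circle_def)
  show ?thesis
  proof (cases "\<theta> < 1/2")
    case True
    then have "above s (1 - \<theta>) x \<Longrightarrow> above s (1/2) x" by (auto intro: above_mono)
    then show ?thesis
      using True x by (cases l) (auto simp: split_part_def letter_at_def)
  next
    case False
    then have "above s (1/2) x \<Longrightarrow> above s (1 - \<theta>) x" by (auto intro: above_mono)
    then show ?thesis
      using False x by (cases l) (auto simp: split_part_def letter_at_def)
  qed
qed

lemma on_circle_turn:
  assumes "on_circle s x"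
  shows "on_circle s (turn \<theta> s x)"
  using assms pos less_1 by (auto simp: on_circle_def turn_def above_def split: if_splits)

lemma frac_turn: "frac (turn \<theta> s x) = frac (x + \<theta>)"
  unfolding frac_eq_frac_iff turn_def
  by (auto intro: exI[of _ "-1"] exI[of _ 0])

lemma rot_pt:
  assumes "on_circle s x"
  shows "rot \<theta> (pt \<theta> s x) = pt \<theta> s (turn \<theta> s x)"
proof -
  let ?y = "turn \<theta> s x"
  have y: "on_circle s ?y" by (rule on_circle_turn[OF assms])
  \<comment> \<open>\<open>rot\<close> works with fractional parts, whereas \<open>turn\<close> on
    the minus side ends at 1 instead of 0; \<open>minus_pt\<close> makes up for this
    difference.\<close>
  have fr: "frac (x + \<theta>) = (if ?y = 1 then 0 else ?y)"
  proof (cases "?y = 1")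
    case True
    then show ?thesis by (simp flip: frac_turn[of s])
  next
    case False
    then have "0 \<le> ?y" "?y < 1" using y by (auto simp: on_circle_def above_def split: if_splits)
    then show ?thesis using False by (simp add: frac_eq flip: frac_turn[of s])
  qed
  have s: "s \<Longrightarrow> ?y \<noteq> 1" "\<not> s \<Longrightarrow> ?y \<noteq> 0"
    using y by (auto simp: on_circle_def above_def)
  show ?thesis
  proof (cases "frac (x + \<theta>) \<in> split_set \<theta>")
    case True
    then have "frac x \<in> split_set \<theta>" by (rule split_set_diff)
    then show ?thesis using True fr s by (cases s) (auto simp: pt_def frac_turn minus_pt_def)
  next
    case False
    then have "?y \<noteq> 1" using fr by auto
    then show ?thesis using False fr by (auto simp: pt_def frac_turn)
  qed
qed

lemma on_circle_turn_power: "on_circle s x \<Longrightarrow> on_circle s ((turn \<theta> s ^^ i) x)"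
  by (induction i) (auto intro: on_circle_turn)

lemma rot_power_pt: "on_circle s x \<Longrightarrow> (rot \<theta> ^^ i) (pt \<theta> s x) = pt \<theta> s ((turn \<theta> s ^^ i) x)"
  by (induction i) (auto simp: rot_pt on_circle_turn_power)

lemma code_pt:
  assumes "on_circle s x"
  shows "code \<theta> (pt \<theta> s x) i = letter_at \<theta> s ((turn \<theta> s ^^ i) x)"
  using assms by (simp add: code_def rot_power_pt pt_in_split_part on_circle_turn_power)

lemma code_rot_power: "code \<theta> ((rot \<theta> ^^ n) p) = (\<lambda>i. code \<theta> p (n + i))"
  by (rule ext) (simp add: code_def add.commute[of n] funpow_add)

lemma split_encodes_orbit_iff:
  assumes "p \<in> split_circle \<theta>"
  shows "split_encodes_orbit \<theta> p u \<longleftrightarrow> u = code \<theta> p"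
proof -
  obtain s x where p: "p = pt \<theta> s x" "on_circle s x" using split_circle_cases[OF assms] .
  then have "split_encodes_orbit \<theta> p u \<longleftrightarrow> (\<forall>i. u i = code \<theta> p i)"
    by (simp add: split_encodes_orbit_def rot_power_pt pt_in_split_part on_circle_turn_power code_pt)
  then show ?thesis by auto
qed

text \<open>Replacing 1 by d + 2k\<theta> turns m - i\<theta> into m d - j\<theta> with j = i - 2km,
  and dividing by d gives a point of the same form for \<open>renorm \<theta>\<close>. The content
  is the sign of the index. Downwards, a negative j forces m \<ge> 1 (m \<ge> 0 in the half-integral
  case), so x would be at least d + \<theta> (or d/2 + \<theta>) and exceed d. Upwards, x \<ge> 0
  with j \<ge> 0 forces m \<ge> 0, so i = j + 2km is a natural number.\<close>

lemma split_set_scale: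
  assumes small: "\<theta> < 1/2" and x: "0 \<le> x" "x \<le> delta \<theta>"
  shows "frac (x / delta \<theta>) \<in> split_set (renorm \<theta>) \<longleftrightarrow> frac x \<in> split_set \<theta>"
proof -
  define d \<theta>' a k where "d = delta \<theta>" and "\<theta>' = renorm \<theta>" and "a = quot_digit \<theta>"
    and "k = half_digit \<theta>"
  have d: "d > 0" "d < 2 * \<theta>" "d \<noteq> 0"
    using delta_pos[OF small] delta_less[OF small] by (simp_all add: d_def)
  have \<theta>: "\<theta> = (real a + \<theta>') * d"
    using theta_eq[OF small] by (simp add: d_def \<theta>'_def a_def)
  have one: "1 = d + 2 * real k * \<theta>"
    using delta_half_digit[OF small] by (simp add: d_def k_def)
  have half: "1/2 = d/2 + real k * \<theta>"
    using one by linarith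
  have k: "k \<ge> 1" unfolding k_def by (rule half_digit_ge_1[OF small])
  have whole_eq: "m - (j + 2 * real k * m) * \<theta> = m * d - j * \<theta>" for m j :: real
  proof -
    have "m = m * (d + 2 * real k * \<theta>)" using one by simp
    then show ?thesis by (simp add: algebra_simps)
  qed
  \<comment> \<open>The extra k in the index comes from 1/2 = d/2 + k\<theta>.\<close>
  have half_eq: "m + 1/2 - (j + real k + 2 * real k * m) * \<theta> = m * d + d/2 - j * \<theta>" for m j :: real
    using whole_eq[of m j] half by (simp add: algebra_simps)
  \<comment> \<open>As \<theta> / d = a + \<theta>', each of the j rotations also shifts the integer
    part by a.\<close>
  have conv: "(m * d - j * \<theta>) / d = (m - j * real a) - j * \<theta>'"
    "(m * d + d/2 - j * \<theta>) / d = (m - j * real a) + 1/2 - j * \<theta>'" for m j :: real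
    using d by (subst \<theta>, simp add: field_simps)+
  have step_le: "j * \<theta> \<le> - \<theta>" if "j \<le> -1" for j :: int
    using mult_right_mono[of "of_int j" "-1" \<theta>] that pos by simp
  show ?thesis
    unfolding d_def[symmetric] \<theta>'_def[symmetric]
  proof
    assume "frac x \<in> split_set \<theta>"
    then obtain m :: int and i :: nat
      where "x = of_int m - real i * \<theta> \<or> x = of_int m + 1/2 - real i * \<theta>"
      unfolding in_split_set_iff by blast
    then show "frac (x / d) \<in> split_set \<theta>'"
    proof
      assume *: "x = of_int m - real i * \<theta>"
      define j where "j = int i - 2 * int k * m"
      have x_eq: "x = of_int m * d - of_int j * \<theta>"
        using * whole_eq[of "of_int m" "of_int j"] by (simp add: j_def)
      have j_ge: "j \<ge> 0"
      proof (rule ccontr)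
        assume "\<not> j \<ge> 0"
        then have "2 * int k * m > 0" unfolding j_def by linarith
        then have "m \<ge> 1" using k by (simp add: zero_less_mult_iff)
        then have "of_int m * d \<ge> 1 * d" using d by (intro mult_right_mono) auto
        moreover have "of_int j * \<theta> \<le> - \<theta>" using \<open>\<not> j \<ge> 0\<close> by (intro step_le) simp
        ultimately show False using x_eq x(2) pos unfolding d_def by linarith
      qed
      have "x / d = of_int (m - j * int a) - real (nat j) * \<theta>'"
        unfolding x_eq conv using j_ge by simp
      then show ?thesis by (rule split_setI)
    next
      assume *: "x = of_int m + 1/2 - real i * \<theta>"
      define j where "j = int i - int k - 2 * int k * m"
      have x_eq: "x = of_int m * d + d/2 - of_int j * \<theta>"
        using * half_eq[of "of_int m" "of_int j"] by (simp add: j_def)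
      have j_ge: "j \<ge> 0"
      proof (rule ccontr)
        assume "\<not> j \<ge> 0"
        then have "int k * (2 * m + 1) > 0"
          unfolding j_def distrib_left by (simp only: mult.assoc mult.left_commute)
        then have "m \<ge> 0" using k by (simp add: zero_less_mult_iff)
        then have "of_int m * d \<ge> 0 * d" using d by (intro mult_right_mono) auto
        moreover have "of_int j * \<theta> \<le> - \<theta>" using \<open>\<not> j \<ge> 0\<close> by (intro step_le) simp
        ultimately show False using x_eq x(2) d unfolding d_def by linarith
      qed
      have "x / d = of_int (m - j * int a) + 1/2 - real (nat j) * \<theta>'"
        unfolding x_eq conv using j_ge by simp
      then show ?thesis by (rule split_setI)
    qed
  next
    assume "frac (x / d) \<in> split_set \<theta>'"
    then obtain m' :: int and j :: nat
      where "x / d = of_int m' - real j * \<theta>' \<or> x / d = of_int m' + 1/2 - real j * \<theta>'"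
      unfolding in_split_set_iff by blast
    then show "frac x \<in> split_set \<theta>"
    proof
      assume *: "x / d = of_int m' - real j * \<theta>'"
      define m where "m = m' + int j * int a"
      have "x / d = (of_int m * d - real j * \<theta>) / d"
        unfolding conv using * by (simp add: m_def)
      then have x_eq: "x = of_int m * d - real j * \<theta>" using d by simp
      moreover have "real j * \<theta> \<ge> 0" using pos by simp
      ultimately have "of_int m * d \<ge> 0" using x by linarith
      then have "m \<ge> 0" using d by (simp add: zero_le_mult_iff)
      then have "x = of_int m - real (j + 2 * k * nat m) * \<theta>"
        using x_eq whole_eq[of "of_int m" "real j"] by simp
      then show ?thesis by (rule split_setI)
    next
      assume *: "x / d = of_int m' + 1/2 - real j * \<theta>'"
      define m where "m = m' + int j * int a"
      have "x / d = (of_int m * d + d/2 - real j * \<theta>) / d"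
        unfolding conv using * by (simp add: m_def)
      then have x_eq: "x = of_int m * d + d/2 - real j * \<theta>" using d by simp
      moreover have "real j * \<theta> \<ge> 0" using pos by simp
      ultimately have "of_int m * d + d/2 \<ge> 0" using x by linarith
      then have "(of_int m + 1/2) * d \<ge> 0" by (simp add: algebra_simps)
      then have "of_int m + 1/2 \<ge> (0::real)" using d by (simp add: zero_le_mult_iff)
      then have "m \<ge> 0" by linarith
      then have "x = of_int m + 1/2 - real (j + k + 2 * k * nat m) * \<theta>"
        using x_eq half_eq[of "of_int m" "real j"] by simp
      then show ?thesis by (rule split_setI)
    qed
  qed
qed

lemma phi_pt_gt_half:
  assumes "\<theta> > 1/2"
  shows "phi \<theta> (pt \<theta> s x) = pt (renorm \<theta>) (\<not> s) (1 - x)"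
proof -
  have "cf_digit 1 \<theta> = 1" using assms cf_digit_1_eq_1_iff by blast
  then show ?thesis
    using split_set_reflect[of x \<theta>] renorm_gt_half[OF assms] by (simp add: phi_def pt_def)
qed

lemma phi_pt_lt_half:
  assumes "\<theta> < 1/2" "on_circle s x" "\<not> above s (delta \<theta>) x"
  shows "phi \<theta> (pt \<theta> s x) = pt (renorm \<theta>) s (x / delta \<theta>)"
proof -
  have "0 \<le> x" "x \<le> delta \<theta>" using assms by (auto simp: on_circle_def above_def split: if_splits)
  note scale = split_set_scale[OF assms(1) this]
  have digit: "cf_digit 1 \<theta> \<noteq> 1" using cf_digit_1_eq_1_iff assms(1) by simp
  have "phi \<theta> (pt \<theta> s x) = scale (inverse (delta \<theta>)) (pt \<theta> s x)"
    unfolding phi_def using digit by (rule if_not_P)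
  moreover have "inverse (delta \<theta>) * x = x / delta \<theta>" by (simp add: divide_inverse)
  ultimately show ?thesis unfolding pt_def scale by simp
qed

lemma on_circle_scale:
  assumes "\<theta> < 1/2" "on_circle s x" "\<not> above s (delta \<theta>) x"
  shows "on_circle s (x / delta \<theta>)"
  using assms delta_pos[OF assms(1)] by (auto simp: on_circle_def above_divide)

lemma on_circle_reflect: "on_circle s x \<Longrightarrow> on_circle (\<not> s) (1 - x)"
  by (auto simp: on_circle_def above_one_minus)

lemma phi_in_split_circle:
  assumes "p \<in> sub_circle \<theta>"
  shows "phi \<theta> p \<in> split_circle (renorm \<theta>)"
proof -
  have "p \<in> split_circle \<theta>" using assms sub_circle_subset by blast
  then obtain s x where p: "p = pt \<theta> s x" "on_circle s x" by (rule split_circle_cases)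
  have sub: "\<not> above s (delta \<theta>) x" using assms p pt_in_sub_circle by simp
  consider "\<theta> < 1/2" | "\<theta> > 1/2" using ne_half by linarith
  then show ?thesis
  proof cases
    case 1
    then show ?thesis
      using p sub by (simp add: phi_pt_lt_half on_circle_scale pt_in_split_circle)
  next
    case 2
    then show ?thesis
      using p by (simp add: phi_pt_gt_half on_circle_reflect pt_in_split_circle)
  qed
qed

text \<open>\<open>trace_sigma\<close> carried over to points of the split circle. For \<theta> >
  1/2 the base interval is the whole circle, each return takes one step, and the reflection lemmas
  supply the conjugation.\<close>

lemma induced_map:
  assumes "p \<in> sub_circle \<theta>"
  defines "w \<equiv> sigma \<theta> (code (renorm \<theta>) (phi \<theta> p) 0)"
  shows "\<forall>i<length w. code \<theta> p i = w ! i"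
    and "(rot \<theta> ^^ length w) p \<in> sub_circle \<theta>"
    and "phi \<theta> ((rot \<theta> ^^ length w) p) = rot (renorm \<theta>) (phi \<theta> p)"
proof -
  interpret r: irrational_angle "renorm \<theta>" by (rule renorm_irrational_angle)
  have "p \<in> split_circle \<theta>" using assms sub_circle_subset by blast
  then obtain s x where p: "p = pt \<theta> s x" and x: "on_circle s x" by (rule split_circle_cases)
  have sub: "\<not> above s (delta \<theta>) x" using assms p x pt_in_sub_circle by simp
  have "(\<forall>i<length w. code \<theta> p i = w ! i) \<and> (rot \<theta> ^^ length w) p \<in> sub_circle \<theta> \<and>
     phi \<theta> ((rot \<theta> ^^ length w) p) = rot (renorm \<theta>) (phi \<theta> p)"
  proof (cases "\<theta> < 1/2")
    case True
    note d = delta_pos[OF True]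
    let ?y = "turn (renorm \<theta>) s (x / delta \<theta>)"
    have phi: "phi \<theta> p = pt (renorm \<theta>) s (x / delta \<theta>)"
      unfolding p by (rule phi_pt_lt_half[OF True x sub])
    have oc: "on_circle s (x / delta \<theta>)" by (rule on_circle_scale[OF True x sub])
    have w: "w = sigma \<theta> (letter_at (renorm \<theta>) s (x / delta \<theta>))"
      unfolding w_def phi using r.code_pt[OF oc, of 0] by simp
    have tr: "trace \<theta> s x w (delta \<theta> * ?y)"
      unfolding w using x sub by (intro trace_sigma[OF True]) (auto simp: on_circle_def)
    then have t: "(turn \<theta> s ^^ length w) x = delta \<theta> * ?y" by (simp add: trace_iff)
    have oy: "on_circle s ?y" by (rule r.on_circle_turn[OF oc])
    have ody: "on_circle s (delta \<theta> * ?y)"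
      using on_circle_turn_power[OF x] t by metis
    have sub': "\<not> above s (delta \<theta>) (delta \<theta> * ?y)"
      using oy above_divide[OF d, of s 1 "delta \<theta> * ?y"] d by (simp add: on_circle_def)
    have "phi \<theta> (pt \<theta> s (delta \<theta> * ?y)) = pt (renorm \<theta>) s ?y"
      using phi_pt_lt_half[OF True ody sub'] d by simp
    then show ?thesis
      using tr pt_in_sub_circle[OF ody] sub'
      by (simp add: p code_pt[OF x] rot_power_pt[OF x] trace_iff phi[unfolded p] r.rot_pt[OF oc])
  next
    case False
    then have gt: "\<theta> > 1/2" using ne_half by simp
    note re = renorm_gt_half[OF gt]
    have phi: "phi \<theta> (pt \<theta> s z) = pt (renorm \<theta>) (\<not> s) (1 - z)" for z
      by (rule phi_pt_gt_half[OF gt])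
    have oc: "on_circle (\<not> s) (1 - x)" by (rule on_circle_reflect[OF x])
    have w: "w = [letter_at \<theta> s x]"
      unfolding w_def p phi sigma_gt_half[OF gt]
      using r.code_pt[OF oc, of 0] letter_at_reflect[OF gt] re by simp
    have "turn (renorm \<theta>) (\<not> s) (1 - x) = 1 - turn \<theta> s x"
      using turn_reflect re by simp
    then show ?thesis
      using pt_in_sub_circle[OF on_circle_turn[OF x]] delta_gt_half[OF gt] on_circle_turn[OF x]
      by (simp add: p w code_pt[OF x] rot_pt[OF x] phi r.rot_pt[OF oc]) (simp add: on_circle_def)
  qed
  then show "\<forall>i<length w. code \<theta> p i = w ! i"
    and "(rot \<theta> ^^ length w) p \<in> sub_circle \<theta>"
    and "phi \<theta> ((rot \<theta> ^^ length w) p) = rot (renorm \<theta>) (phi \<theta> p)"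
    by blast+
qed

end

section \<open>Limits of words\<close>

text \<open>Codings are compared through their finite prefixes, which avoids extending substitutions
  to infinite words.\<close>

definition prefix_of :: "letter list \<Rightarrow> letter word \<Rightarrow> bool" where
  "prefix_of w u \<longleftrightarrow> (\<forall>i<length w. u i = w ! i)"

lemma prefix_of_Nil [simp]: "prefix_of [] u"
  by (simp add: prefix_of_def)

lemma prefix_of_append:
  "prefix_of (v @ w) u \<longleftrightarrow> prefix_of v u \<and> prefix_of w (\<lambda>i. u (length v + i))"
proof
  assume *: "prefix_of (v @ w) u"
  show "prefix_of v u \<and> prefix_of w (\<lambda>i. u (length v + i))"
    unfolding prefix_of_def
  proof (intro conjI allI impI)
    show "u i = v ! i" if "i < length v" for i
      using * that by (simp add: prefix_of_def nth_append)
    show "u (length v + i) = w ! i" if "i < length w" for i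
      using * that by (simp add: prefix_of_def nth_append)
  qed
next
  assume *: "prefix_of v u \<and> prefix_of w (\<lambda>i. u (length v + i))"
  show "prefix_of (v @ w) u"
    unfolding prefix_of_def
  proof (intro allI impI)
    fix i
    assume i: "i < length (v @ w)"
    show "u i = (v @ w) ! i"
    proof (cases "i < length v")
      case False
      then have "u (length v + (i - length v)) = w ! (i - length v)"
        using * i unfolding prefix_of_def by (metis add_less_cancel_left length_append le_add_diff_inverse not_less)
      then show ?thesis using False by (simp add: nth_append)
    qed (use * in \<open>simp add: prefix_of_def nth_append\<close>)
  qed
qed

lemma prefix_of_map [simp]: "prefix_of (map u [0..<n]) u"
  by (simp add: prefix_of_def)

lemma prefix_of_Cons: "prefix_of (l # w) u \<longleftrightarrow> u 0 = l \<and> prefix_of w (\<lambda>i. u (Suc i))"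
  using prefix_of_append[of "[l]" w u] by (simp add: prefix_of_def)

lemma word_limitI:
  assumes "\<And>n. prefix_of (W n) u" and "\<And>L. \<forall>\<^sub>F n in sequentially. L \<le> length (W n)"
  shows "word_limit W u"
  unfolding word_limit_def
proof
  fix i
  show "\<forall>\<^sub>F n in sequentially. i < length (W n) \<and> W n ! i = u i"
    using assms(2)[of "Suc i"]
  proof eventually_elim
    case (elim n)
    then show ?case using assms(1)[of n] by (auto simp: prefix_of_def)
  qed
qed

lemma eventually_length_ge:
  assumes "\<And>n. length (W n) \<le> length (W (Suc n))"
    and "\<And>n. \<exists>m\<ge>n. length (W m) < length (W (Suc m))"
  shows "\<forall>\<^sub>F n in sequentially. L \<le> length (W n)"
proof (induction L)
  case (Suc L)
  then obtain n where n: "\<And>m. m \<ge> n \<Longrightarrow> L \<le> length (W m)"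
    by (auto simp: eventually_sequentially)
  obtain m where m: "m \<ge> n" "length (W m) < length (W (Suc m))" using assms(2) by blast
  have "Suc L \<le> length (W i)" if "i \<ge> Suc m" for i
  proof -
    have "length (W (Suc m)) \<le> length (W i)"
      by (rule lift_Suc_mono_le[of "\<lambda>n. length (W n)", OF assms(1) that])
    then show ?thesis using m n[of m] by linarith
  qed
  then show ?case unfolding eventually_sequentially by blast
qed simp

section \<open>Compositions of substitutions and their limits\<close>

lemma apply_subst_simps [simp]:
  "apply_subst s [] = []"
  "apply_subst s (l # w) = s l @ apply_subst s w"
  "apply_subst s (v @ w) = apply_subst s v @ apply_subst s w"
  by (simp_all add: apply_subst_def)

lemma apply_subst_id: "(\<And>l. s l = [l]) \<Longrightarrow> apply_subst s w = w"
  by (induction w) simp_all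

lemma length_apply_subst_ge: "(\<And>l. s l \<noteq> []) \<Longrightarrow> length w \<le> length (apply_subst s w)"
proof (induction w)
  case (Cons l w)
  have "length (s l) > 0" using Cons.prems by simp
  then show ?case
    using Cons.IH[OF Cons.prems] unfolding apply_subst_simps length_append length_Cons by linarith
qed simp

lemma compose_seg_refl [simp]: "compose_seg F n n w = w"
  by (simp add: compose_seg_def)

lemma compose_seg_Suc: "m \<le> n \<Longrightarrow> compose_seg F m (Suc n) w = compose_seg F m n (F n w)"
  by (simp add: compose_seg_def)

lemma compose_seg_split:
  "m \<le> k \<Longrightarrow> k \<le> n \<Longrightarrow> compose_seg F m n w = compose_seg F m k (compose_seg F k n w)"
  by (induction n arbitrary: w rule: nat_induct)
    (auto simp: compose_seg_Suc le_Suc_eq)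

lemma nested_prefix_0 [simp]: "nested_prefix s \<omega> 0 = []"
  by (simp add: nested_prefix_def)

lemma nested_prefix_Suc:
  "nested_prefix s \<omega> (Suc n) =
     nested_prefix s \<omega> n @ compose_seg (\<lambda>m. apply_subst (s m)) 0 n (\<omega> n)"
  by (simp add: nested_prefix_def)

text \<open>The combinatorial facts that drive convergence, detached from rotations. The proper
  levels will be those with angle below 1/2.\<close>

locale proper_substitutions =
  fixes s :: "nat \<Rightarrow> letter \<Rightarrow> letter list" and proper :: "nat \<Rightarrow> bool"
  assumes improper: "\<not> proper n \<Longrightarrow> s n l = [l]"
    and proper_A: "proper n \<Longrightarrow> \<exists>r. s n l = A # r"
    and proper_AA: "proper n \<Longrightarrow> \<exists>r. r \<noteq> [] \<and> s n A = A # r"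
    and infinitely_proper: "\<exists>m\<ge>n. proper m"
begin

abbreviation image :: "nat \<Rightarrow> nat \<Rightarrow> letter list \<Rightarrow> letter list" where
  "image \<equiv> compose_seg (\<lambda>m. apply_subst (s m))"

lemma s_nonempty: "s n l \<noteq> []"
  using improper[of n l] proper_A[of n l] by (cases "proper n") auto

lemma image_append: "image m n (v @ w) = image m n v @ image m n w"
  by (induction n arbitrary: v w) (auto simp: compose_seg_def)

lemma length_image_ge: "length w \<le> length (image m n w)"
proof (induction n arbitrary: w)
  case (Suc n)
  show ?case
  proof (cases "m \<le> n")
    case True
    have "length w \<le> length (apply_subst (s n) w)"
      using s_nonempty by (rule length_apply_subst_ge)
    also have "\<dots> \<le> length (image m (Suc n) w)" using Suc True by (simp add: compose_seg_Suc)
    finally show ?thesis .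
  qed (simp add: compose_seg_def)
qed (simp add: compose_seg_def)

lemma apply_subst_starts_with_A:
  assumes "proper n" "w \<noteq> []"
  obtains r where "apply_subst (s n) w = A # r"
proof -
  obtain l v where w: "w = l # v" using assms(2) by (cases w) auto
  obtain r where "s n l = A # r" using proper_A[OF assms(1)] by blast
  then show ?thesis using that by (simp add: w)
qed

lemma length_image_A:
  assumes "m \<le> n"
  shows "length (image m n [A]) \<le> length (image m (Suc n) [A])"
    and "proper n \<Longrightarrow> length (image m n [A]) < length (image m (Suc n) [A])"
proof -
  have "length (image m n [A]) < length (image m (Suc n) [A])" if pr: "proper n"
  proof -
    obtain r where r: "r \<noteq> []" "s n A = A # r" using proper_AA[OF pr] by blast
    have "image m (Suc n) [A] = image m n [A] @ image m n r"
      using assms r image_append[of m n "[A]" r] by (simp add: compose_seg_Suc)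
    moreover have "length (image m n r) > 0"
      using length_image_ge[of r m n] r by (cases r) auto
    ultimately show ?thesis by simp
  qed
  moreover have "image m (Suc n) [A] = image m n [A]" if "\<not> proper n"
    using assms improper[OF that] by (simp add: compose_seg_Suc)
  ultimately show "length (image m n [A]) \<le> length (image m (Suc n) [A])"
    and "proper n \<Longrightarrow> length (image m n [A]) < length (image m (Suc n) [A])"
    by (cases "proper n"; simp)+
qed

text \<open>\<open>c n\<close> plays the role of the coding at level n, with empty words between the
  levels from N on.\<close>

context
  fixes N :: nat and c :: "nat \<Rightarrow> letter word"
  assumes descend: "n \<ge> N \<Longrightarrow> prefix_of w (c (Suc n)) \<Longrightarrow> prefix_of (apply_subst (s n) w) (c n)"
begin

lemma prefix_of_image: "N \<le> n \<Longrightarrow> prefix_of w (c n) \<Longrightarrow> prefix_of (image N n w) (c N)"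
proof (induction n arbitrary: w)
  case (Suc n)
  show ?case
  proof (cases "N \<le> n")
    case True
    then show ?thesis
      using Suc.IH[OF True descend[OF True Suc.prems(2)]] by (simp add: compose_seg_Suc)
  next
    case False
    then show ?thesis using Suc.prems by (simp add: le_Suc_eq)
  qed
qed simp

text \<open>At the next proper level the coding begins with the image of some letter, hence with
  \<open>A\<close>. Going back down to n, proper levels produce \<open>A\<close> again and improper
  ones copy it.\<close>

lemma starts_with_A:
  assumes "N \<le> n"
  shows "c n 0 = A"
proof -
  obtain m where m: "m \<ge> n" "proper m" using infinitely_proper by blast
  from m(1) show ?thesis
  proof (induction rule: inc_induct)
    case base
    have "prefix_of (apply_subst (s m) [c (Suc m) 0]) (c m)"
      using assms m by (intro descend) (auto simp: prefix_of_def)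
    moreover obtain r where "apply_subst (s m) [c (Suc m) 0] = A # r"
      using apply_subst_starts_with_A[OF m(2), of "[c (Suc m) 0]"] by blast
    ultimately show ?case by (simp add: prefix_of_Cons)
  next
    case (step k)
    have "prefix_of (apply_subst (s k) [A]) (c k)"
      using assms step by (intro descend) (auto simp: prefix_of_def)
    moreover have "\<exists>r. apply_subst (s k) [A] = A # r"
      using proper_A[of k A] improper[of k A] by (cases "proper k") auto
    ultimately show ?case by (auto simp: prefix_of_Cons)
  qed
qed

lemma word_limit_image:
  assumes "w \<noteq> []"
  shows "word_limit (\<lambda>m. image N m w) (c N)"
  unfolding word_limit_def
proof
  fix i
  have "\<forall>\<^sub>F n in sequentially. Suc i \<le> length (image N (N + n) [A])"
  proof (rule eventually_length_ge)
    show "length (image N (N + n) [A]) \<le> length (image N (N + Suc n) [A])" for n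
      using length_image_A(1)[of N "N + n"] by simp
    show "\<exists>m\<ge>n. length (image N (N + m) [A]) < length (image N (N + Suc m) [A])" for n
    proof -
      obtain m where "m \<ge> N + n" "proper m" using infinitely_proper by blast
      then show ?thesis
        using length_image_A(2)[of N m] by (intro exI[of _ "m - N"]) simp
    qed
  qed
  then obtain n0 where n0: "\<And>n. n \<ge> n0 \<Longrightarrow> Suc i \<le> length (image N (N + n) [A])"
    by (auto simp: eventually_sequentially)
  \<comment> \<open>Any nonempty word passing through the proper level p acquires the first letter
    \<open>A\<close>. So for m > p the image of \<open>w\<close> starts with the image of
    \<open>[A]\<close> from level p, which is already longer than i and is a prefix of
    \<open>c N\<close>.\<close>
  obtain p where p: "p \<ge> N + n0" "proper p" using infinitely_proper by blast
  have len: "i < length (image N p [A])" using n0[of "p - N"] p by (simp add: le_diff_conv2)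
  have "prefix_of (image N p [A]) (c N)"
    using p starts_with_A[of p] by (intro prefix_of_image) (auto simp: prefix_of_def)
  then have eq: "image N p [A] ! i = c N i" using len by (simp add: prefix_of_def)
  have "i < length (image N m w) \<and> image N m w ! i = c N i" if "m \<ge> Suc p" for m
  proof -
    have ne: "image (Suc p) m w \<noteq> []"
      using length_image_ge[of w "Suc p" m] assms by auto
    obtain r where r: "apply_subst (s p) (image (Suc p) m w) = A # r"
      using p(2) ne by (rule apply_subst_starts_with_A)
    have "image N m w = image N p (A # r)"
      using p that r compose_seg_split[of N "Suc p" m "\<lambda>m. apply_subst (s m)" w]
      by (simp add: compose_seg_Suc)
    also have "\<dots> = image N p [A] @ image N p r"
      using image_append[of N p "[A]" r] by simp
    finally show ?thesis using len eq by (simp add: nth_append)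
  qed
  then show "\<forall>\<^sub>F m in sequentially. i < length (image N m w) \<and> image N m w ! i = c N i"
    unfolding eventually_sequentially by blast
qed

end

text \<open>The invariant \<open>pre\<close> serves both cases of \<open>nested_word\<close>. With
  infinitely many nonempty words the partial products themselves grow; otherwise the tail from N on
  is the limit of images of \<open>[A]\<close>, and its prefixes are pushed down to level 0.\<close>

lemma nested_wordI:
  assumes descend: "\<And>n w. prefix_of w (c (Suc n)) \<Longrightarrow> prefix_of (\<omega> n @ apply_subst (s n) w) (c n)"
  shows "nested_word s \<omega> (c 0)"
proof -
  have pre: "prefix_of w (c n) \<Longrightarrow> prefix_of (nested_prefix s \<omega> n @ image 0 n w) (c 0)" for n w
  proof (induction n arbitrary: w)
    case (Suc n)
    from Suc.IH[OF descend[OF Suc.prems]] show ?case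
      by (simp add: nested_prefix_Suc image_append compose_seg_Suc)
  qed simp
  show ?thesis
  proof (cases "infinite {n. \<omega> n \<noteq> []}")
    case True
    have "word_limit (\<lambda>n. nested_prefix s \<omega> (Suc n)) (c 0)"
    proof (rule word_limitI)
      show "prefix_of (nested_prefix s \<omega> (Suc n)) (c 0)" for n
        using pre[of "[]" "Suc n"] by (simp add: prefix_of_append)
      show "\<forall>\<^sub>F n in sequentially. L \<le> length (nested_prefix s \<omega> (Suc n))" for L
      proof (rule eventually_length_ge)
        show "length (nested_prefix s \<omega> (Suc n)) \<le> length (nested_prefix s \<omega> (Suc (Suc n)))" for n
          by (simp add: nested_prefix_Suc[of _ _ "Suc n"])
        show "\<exists>m\<ge>n. length (nested_prefix s \<omega> (Suc m)) < length (nested_prefix s \<omega> (Suc (Suc m)))"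
          for n
        proof -
          obtain m where m: "m > Suc n" "\<omega> m \<noteq> []"
            using True unfolding infinite_nat_iff_unbounded by blast
          then obtain k where k: "m = Suc k" by (cases m) auto
          have "length (image 0 m (\<omega> m)) > 0"
            using length_image_ge[of "\<omega> m" 0 m] m by (cases "\<omega> m") auto
          then show ?thesis
            using m k by (intro exI[of _ k]) (auto simp: nested_prefix_Suc[of s \<omega> "Suc k"])
        qed
      qed
    qed
    then show ?thesis using True by (simp add: nested_word_def)
  next
    case False
    have "\<exists>v v'. word_limit (\<lambda>m. image N (Suc m) [A]) v \<and>
             word_limit (\<lambda>m. image 0 N (map v [0..<m])) v' \<and> c 0 = nested_prefix s \<omega> N \<frown> v'"
      if N: "\<forall>n\<ge>N. \<omega> n = []" for N
    proof (intro exI conjI)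
      let ?v' = "\<lambda>i. c 0 (length (nested_prefix s \<omega> N) + i)"
      have "word_limit (\<lambda>m. image N m [A]) (c N)"
        by (rule word_limit_image) (use descend N in force)+
      then show "word_limit (\<lambda>m. image N (Suc m) [A]) (c N)"
        unfolding word_limit_def by (subst eventually_sequentially_Suc)
      show "word_limit (\<lambda>m. image 0 N (map (c N) [0..<m])) ?v'"
      proof (rule word_limitI)
        show "prefix_of (image 0 N (map (c N) [0..<m])) ?v'" for m
          using pre[OF prefix_of_map, of N m] by (simp add: prefix_of_append)
        show "\<forall>\<^sub>F m in sequentially. L \<le> length (image 0 N (map (c N) [0..<m]))" for L
          unfolding eventually_sequentially
        proof (intro exI allI impI)
          fix m
          assume "L \<le> m"
          then show "L \<le> length (image 0 N (map (c N) [0..<m]))"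
            using length_image_ge[of "map (c N) [0..<m]" 0 N] by simp
        qed
      qed
      show "c 0 = nested_prefix s \<omega> N \<frown> ?v'"
      proof
        fix i
        have "prefix_of (nested_prefix s \<omega> N) (c 0)"
          using pre[of "[]" N] by (simp add: prefix_of_append)
        then show "c 0 i = (nested_prefix s \<omega> N \<frown> ?v') i" by (simp add: conc_def prefix_of_def)
      qed
    qed
    then show ?thesis using False by (simp add: nested_word_def)
  qed
qed

end

section \<open>Half-open partitions and visits to the base interval\<close>

context irrational_angle
begin

lemma half_open_part_iff:
  assumes "0 \<le> y" "y < 1"
  shows "y \<in> half_open_part \<theta> l \<longleftrightarrow> l = letter_at \<theta> True y"
  using assms pos by (cases l) (auto simp: half_open_part_def letter_at_def above_def)

lemma half_open_part_subset: "half_open_part \<theta> l \<subseteq> {0..<1}"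
  using pos less_1 by (cases l) (auto simp: half_open_part_def)

lemma frac_turn_power: "frac ((turn \<theta> s ^^ i) x) = frac (x + real i * \<theta>)"
proof (induction i)
  case (Suc i)
  have "frac ((turn \<theta> s ^^ Suc i) x) = frac ((turn \<theta> s ^^ i) x + \<theta>)"
    by (simp add: frac_turn)
  also have "\<dots> = frac (x + real (Suc i) * \<theta>)"
    using Suc.IH unfolding frac_eq_frac_iff by (auto simp: algebra_simps)
  finally show ?case .
qed simp

lemma turn_power_True:
  assumes "on_circle True x"
  shows "(turn \<theta> True ^^ i) x = frac (x + real i * \<theta>)"
  using on_circle_turn_power[OF assms, of i]
  by (simp add: on_circle_def above_def frac_eq flip: frac_turn_power[where s = True])

lemma turn_power_False:
  assumes "on_circle False x"
  shows "(turn \<theta> False ^^ i) x = (let y = frac (x + real i * \<theta>) in if y = 0 then 1 else y)"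
proof (cases "(turn \<theta> False ^^ i) x = 1")
  case True
  then show ?thesis by (simp add: Let_def flip: frac_turn_power[where s = False])
next
  case False
  then have "0 < (turn \<theta> False ^^ i) x" "(turn \<theta> False ^^ i) x < 1"
    using on_circle_turn_power[OF assms, of i] by (auto simp: on_circle_def above_def)
  then have "frac ((turn \<theta> False ^^ i) x) = (turn \<theta> False ^^ i) x" by (simp add: frac_eq)
  then show ?thesis
    using \<open>0 < _\<close> by (simp add: Let_def flip: frac_turn_power[where s = False])
qed

lemma encodes_orbit_True:
  assumes "on_circle True x"
  shows "encodes_orbit (half_open_part \<theta>) \<theta> x (code \<theta> (pt \<theta> True x))"
  unfolding encodes_orbit_def
  using assms by (simp add: half_open_part_iff frac_lt_1 code_pt turn_power_True)

lemma endpoint_change_half_open: "endpoint_change \<theta> (half_open_part \<theta>)"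
proof -
  have "\<forall>y\<in>{0..<1}. \<exists>!l. y \<in> half_open_part \<theta> l"
    using half_open_part_iff by simp
  moreover have "0 \<in> half_open_part \<theta> A \<union> half_open_part \<theta> C"
    "1/2 \<in> half_open_part \<theta> A \<union> half_open_part \<theta> B"
    "1-\<theta> \<in> half_open_part \<theta> B \<union> half_open_part \<theta> C"
    using pos less_1 ne_half by (auto simp: half_open_part_def)
  ultimately show ?thesis
    unfolding endpoint_change_def using half_open_part_subset by blast
qed

text \<open>The partition seen by minus points: intervals closed on the right, with 0 read as the
  position 1.\<close>

definition left_open_part :: "letter \<Rightarrow> real set" where
  "left_open_part l = {y \<in> {0..<1}. letter_at \<theta> False (if y = 0 then 1 else y) = l}"

lemma endpoint_change_left_open: "endpoint_change \<theta> left_open_part"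
proof -
  have "left_open_part l - {0, 1/2, 1-\<theta>} = half_open_part \<theta> l - {0, 1/2, 1-\<theta>}" for l
  proof -
    have "letter_at \<theta> False y = letter_at \<theta> True y" if "y \<notin> {1/2, 1-\<theta>}" for y
      using that by (auto simp: letter_at_def above_def)
    then show ?thesis
      using half_open_part_subset[of l] by (auto simp: left_open_part_def half_open_part_iff)
  qed
  then show ?thesis
    using pos less_1 ne_half
    unfolding endpoint_change_def
    by (auto simp: left_open_part_def letter_at_def above_def)
qed

lemma encodes_up_to_endpoints_code:
  assumes "x0 \<in> lifts \<theta> x" "0 \<le> x" "x < 1"
  shows "encodes_up_to_endpoints \<theta> x (code \<theta> x0)"
  using assms
proof (cases rule: lifts_cases)
  case plus
  then show ?thesis
    using encodes_orbit_True endpoint_change_half_open by (auto simp: encodes_up_to_endpoints_def)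
next
  case minus
  have "encodes_orbit left_open_part \<theta> x (code \<theta> x0)"
    unfolding encodes_orbit_def
    using minus by (simp add: left_open_part_def frac_lt_1 code_pt turn_power_False Let_def)
  then show ?thesis using endpoint_change_left_open by (auto simp: encodes_up_to_endpoints_def)
next
  case one
  have "frac (1 + real i * \<theta>) = frac (real i * \<theta>)" for i
    by (metis frac_1_eq add.commute)
  then have "encodes_orbit left_open_part \<theta> x (code \<theta> x0)"
    unfolding encodes_orbit_def
    using one by (simp add: left_open_part_def frac_lt_1 code_pt turn_power_False Let_def)
  then show ?thesis using endpoint_change_left_open by (auto simp: encodes_up_to_endpoints_def)
qed

lemma multiple_in_Rats:
  assumes "of_int k * \<theta> \<in> \<rat>"
  shows "k = 0"
proof (rule ccontr)
  assume "k \<noteq> 0"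
  then have "\<theta> = (of_int k * \<theta>) / of_int k" by simp
  also have "\<dots> \<in> \<rat>" using assms by (intro Rats_divide) auto
  finally show False using irrational by contradiction
qed

lemma frac_orbit_diff:
  assumes "frac (x + real i * \<theta>) - frac (x + real j * \<theta>) \<in> \<rat>"
  shows "i = j"
proof -
  have "of_int (int i - int j) * \<theta> = (frac (x + real i * \<theta>) - frac (x + real j * \<theta>))
      + of_int (\<lfloor>x + real i * \<theta>\<rfloor> - \<lfloor>x + real j * \<theta>\<rfloor>)"
    by (simp add: frac_def algebra_simps)
  also have "\<dots> \<in> \<rat>" using assms by (intro Rats_add) auto
  finally show ?thesis using multiple_in_Rats by fastforce
qed

text \<open>By irrationality each endpoint is met at most once. Meeting 1/2 excludes 0, as their
  difference is rational, and also 1 - \<theta>, whose successor is 0. So the hits are at most one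
  visit to 1/2, or at most one each to 0 and 1 - \<theta>.\<close>

lemma card_orbit_hits:
  "finite {i. frac (x + real i * \<theta>) \<in> {0, 1/2, 1-\<theta>}} \<and>
     card {i. frac (x + real i * \<theta>) \<in> {0, 1/2, 1-\<theta>}} \<le> 2"
proof -
  define H where "H c = {i :: nat. frac (x + real i * \<theta>) = c}" for c
  have half: "(1/2 :: real) \<in> \<rat>" by (intro Rats_divide) auto
  have one: "\<exists>i. H c \<subseteq> {i}" for c
  proof (cases "H c = {}")
    case False
    then obtain i where "i \<in> H c" by blast
    then have "j = i" if "j \<in> H c" for j
      using that frac_orbit_diff[of x j i] by (simp add: H_def)
    then show ?thesis by blast
  qed simp
  have 1: "H (1/2) = {} \<or> H 0 = {}"
  proof (rule ccontr)
    assume "\<not> ?thesis"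
    then obtain i j where ij: "frac (x + real i * \<theta>) = 1/2" "frac (x + real j * \<theta>) = 0"
      unfolding H_def by auto
    then have "frac (x + real i * \<theta>) - frac (x + real j * \<theta>) \<in> \<rat>"
      unfolding ij using half by simp
    then have "i = j" by (rule frac_orbit_diff)
    then show False using ij by simp
  qed
  have 2: "H (1/2) = {} \<or> H (1-\<theta>) = {}"
  proof (rule ccontr)
    assume "\<not> ?thesis"
    then obtain i j where ij: "i \<in> H (1/2)" "j \<in> H (1-\<theta>)" by auto
    then have "frac (x + real j * \<theta>) = frac (1 - \<theta>)"
      using pos less_1 by (simp add: H_def frac_eq)
    then obtain m :: int where "x + real j * \<theta> = of_int m + (1 - \<theta>)"
      unfolding frac_eq_frac_iff ..
    then have "x + real (Suc j) * \<theta> = of_int (m + 1) + 0" by (simp add: algebra_simps)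
    then have "frac (x + real (Suc j) * \<theta>) = frac 0" unfolding frac_eq_frac_iff by blast
    then have "Suc j \<in> H 0" by (simp add: H_def)
    then show False using 1 ij by blast
  qed
  have hits: "{i. frac (x + real i * \<theta>) \<in> {0, 1/2, 1-\<theta>}} = H (1/2) \<union> H 0 \<union> H (1-\<theta>)"
    unfolding H_def by blast
  obtain a b c where "H (1/2) \<subseteq> {a}" "H 0 \<subseteq> {b}" "H (1-\<theta>) \<subseteq> {c}" using one by metis
  then have "H (1/2) \<union> H 0 \<union> H (1-\<theta>) \<subseteq> {a, a} \<or> H (1/2) \<union> H 0 \<union> H (1-\<theta>) \<subseteq> {b, c}"
    using 1 2 by blast
  then obtain a b where ab: "{i. frac (x + real i * \<theta>) \<in> {0, 1/2, 1-\<theta>}} \<subseteq> {a, b}"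
    unfolding hits by blast
  have "card {a, b} \<le> 2" by (simp add: card_insert_if)
  then show ?thesis
    using finite_subset[OF ab] card_mono[OF _ ab] by simp
qed

lemma encodes_up_to_two_errorsI:
  assumes "encodes_up_to_endpoints \<theta> x u"
  shows "encodes_up_to_two_errors \<theta> x u"
proof -
  obtain P where "endpoint_change \<theta> P" and enc: "encodes_orbit P \<theta> x u"
    using assms unfolding encodes_up_to_endpoints_def by blast
  then have P: "P l - {0, 1/2, 1-\<theta>} = half_open_part \<theta> l - {0, 1/2, 1-\<theta>}" for l
    unfolding endpoint_change_def by blast
  have "{i. frac (x + real i * \<theta>) \<notin> half_open_part \<theta> (u i)} \<subseteq>
        {i. frac (x + real i * \<theta>) \<in> {0, 1/2, 1-\<theta>}}"
  proof
    fix i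
    assume "i \<in> {i. frac (x + real i * \<theta>) \<notin> half_open_part \<theta> (u i)}"
    moreover have "frac (x + real i * \<theta>) \<in> P (u i)" using enc by (simp add: encodes_orbit_def)
    ultimately have "frac (x + real i * \<theta>) \<in> {0, 1/2, 1-\<theta>}" using P[of "u i"] by blast
    then show "i \<in> {i. frac (x + real i * \<theta>) \<in> {0, 1/2, 1-\<theta>}}" by (rule CollectI)
  qed
  then show ?thesis
    unfolding encodes_up_to_two_errors_def
    using card_orbit_hits[of x] by (meson card_mono finite_subset le_trans)
qed

text \<open>Each rotation that does not wrap raises the position by \<theta>, which lowers n by one;
  the first one that wraps lands below \<theta>.\<close>

lemma reaches_theta:
  assumes small: "\<theta> < 1/2"
  shows "on_circle s x \<Longrightarrow> above s (1 - real n * \<theta>) x \<Longrightarrow> \<exists>k. \<not> above s \<theta> ((turn \<theta> s ^^ k) x)"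
proof (induction n arbitrary: x)
  case 0
  then show ?case by (simp add: on_circle_def)
next
  case (Suc n)
  show ?case
  proof (cases "above s (1 - \<theta>) x")
    case True
    then have "turn \<theta> s x = x - (1 - \<theta>)" by (simp add: turn_def above_plus)
    then have "\<not> above s \<theta> (turn \<theta> s x)"
      using Suc.prems(1) by (simp add: above_minus on_circle_def)
    then show ?thesis by (intro exI[of _ 1]) simp
  next
    case False
    then have "turn \<theta> s x = x + \<theta>" by (simp add: turn_def above_plus)
    then have "above s (1 - real n * \<theta>) (turn \<theta> s x)"
      using Suc.prems(2) by (simp only: above_plus) (simp add: algebra_simps)
    then obtain k where "\<not> above s \<theta> ((turn \<theta> s ^^ k) (turn \<theta> s x))"
      using Suc.IH[OF on_circle_turn[OF Suc.prems(1)]] by blast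
    then show ?thesis by (intro exI[of _ "Suc k"]) (simp add: funpow_swap1)
  qed
qed

text \<open>Below \<theta> the block \<open>block_Q\<close> applies and brings the orbit down by
  \<open>delta \<theta>\<close>; n bounds the number of such descents.\<close>

lemma reaches_delta:
  assumes small: "\<theta> < 1/2"
  shows "on_circle s y \<Longrightarrow> \<not> above s \<theta> y \<Longrightarrow> \<not> above s (real n * delta \<theta>) y \<Longrightarrow>
    \<exists>k. \<not> above s (delta \<theta>) ((turn \<theta> s ^^ k) y)"
proof (induction n arbitrary: y)
  case 0
  then show ?case by (simp add: on_circle_def)
next
  case (Suc n)
  have d: "delta \<theta> > 0" by (rule delta_pos[OF small])
  show ?case
  proof (cases "above s (delta \<theta>) y")
    case False
    then show ?thesis by (intro exI[of _ 0]) simp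
  next
    case True
    have "\<not> above s (\<theta> + delta \<theta> / 2) y"
      using Suc.prems(2) by (rule not_above_mono) (use d in simp)
    from trace_block_Q[OF small True this]
    obtain l where l: "(turn \<theta> s ^^ l) y = y - delta \<theta>" by (auto simp: trace_iff)
    have "on_circle s (y - delta \<theta>)" using on_circle_turn_power[OF Suc.prems(1)] l by metis
    moreover have "\<not> above s \<theta> (y - delta \<theta>)"
      unfolding above_minus using Suc.prems(2) by (rule not_above_mono) (use d in simp)
    moreover have "\<not> above s (real n * delta \<theta>) (y - delta \<theta>)"
      unfolding above_minus using Suc.prems(3) by (simp add: algebra_simps)
    ultimately obtain k where "\<not> above s (delta \<theta>) ((turn \<theta> s ^^ k) (y - delta \<theta>))"
      using Suc.IH by blast
    then have "\<not> above s (delta \<theta>) ((turn \<theta> s ^^ (k + l)) y)" by (simp add: funpow_add l)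
    then show ?thesis ..
  qed
qed

lemma reaches_sub_circle:
  assumes "p \<in> split_circle \<theta>"
  shows "\<exists>k. (rot \<theta> ^^ k) p \<in> sub_circle \<theta>"
proof -
  obtain s x where p: "p = pt \<theta> s x" and x: "on_circle s x" using split_circle_cases[OF assms] .
  have "\<exists>k. \<not> above s (delta \<theta>) ((turn \<theta> s ^^ k) x)"
  proof (cases "\<theta> < 1/2")
    case True
    obtain n where "1 < real n * \<theta>" using reals_Archimedean3[OF pos] by blast
    then have "above s (1 - real n * \<theta>) x"
      using x unfolding on_circle_def by (auto intro: above_mono)
    then obtain k where k: "\<not> above s \<theta> ((turn \<theta> s ^^ k) x)" using reaches_theta[OF True x] by blast
    let ?y = "(turn \<theta> s ^^ k) x"
    have y: "on_circle s ?y" using x by (rule on_circle_turn_power)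
    obtain n where "1 < real n * delta \<theta>" using reals_Archimedean3[OF delta_pos[OF True]] by blast
    then have "\<not> above s (real n * delta \<theta>) ?y"
      using y unfolding on_circle_def by (meson less_imp_le not_above_mono)
    then obtain l where "\<not> above s (delta \<theta>) ((turn \<theta> s ^^ l) ?y)"
      using reaches_delta[OF True y k] by blast
    then have "\<not> above s (delta \<theta>) ((turn \<theta> s ^^ (l + k)) x)" by (simp add: funpow_add)
    then show ?thesis ..
  next
    case False
    then have "delta \<theta> = 1" using delta_gt_half ne_half by simp
    then show ?thesis using x by (intro exI[of _ 0]) (simp add: on_circle_def)
  qed
  then show ?thesis
    using x by (simp add: p rot_power_pt pt_in_sub_circle on_circle_turn_power)
qed

end

section \<open>Codings under renormalization\<close>

lemma theta_seq_0 [simp]: "theta_seq \<theta> 0 = \<theta>"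
  and theta_seq_Suc: "theta_seq \<theta> (Suc n) = renorm (theta_seq \<theta> n)"
  and theta_seq_renorm: "theta_seq (renorm \<theta>) n = theta_seq \<theta> (Suc n)"
  by (simp_all add: theta_seq_def funpow_swap1)

lemma renorm_point_renorm:
  "renorm_point (renorm \<theta>) (phi \<theta> q) (\<lambda>_. 0) n = renorm_point \<theta> q (\<lambda>_. 0) (Suc n)"
proof (induction n)
  case (Suc n)
  then show ?case by (simp add: theta_seq_renorm)
qed simp

lemma allowed_renorm:
  "allowed (renorm \<theta>) (phi \<theta> q) (\<lambda>_. 0) n \<longleftrightarrow> allowed \<theta> q (\<lambda>_. 0) (Suc n)"
  unfolding allowed_def renorm_point_renorm theta_seq_renorm by simp

text \<open>\<open>tilde_circle\<close> recurses by changing the angle, \<open>allowed\<close> by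
  iterating the point. The induction therefore varies \<theta> and q, and the shift lemmas match
  level n + 1 for \<theta> with level n for \<open>renorm \<theta>\<close>.\<close>

lemma tilde_circle_iff_allowed:
  "irrational_angle \<theta> \<Longrightarrow> q \<in> split_circle \<theta> \<Longrightarrow>
     q \<in> tilde_circle n \<theta> \<longleftrightarrow> (\<forall>m<n. allowed \<theta> q (\<lambda>_. 0) m)"
proof (induction n arbitrary: \<theta> q)
  case (Suc n)
  interpret irrational_angle \<theta> by fact
  have "allowed \<theta> q (\<lambda>_. 0) 0 \<longleftrightarrow> q \<in> sub_circle \<theta>" by (simp add: allowed_def)
  moreover have "phi \<theta> q \<in> tilde_circle n (renorm \<theta>) \<longleftrightarrow> (\<forall>m<n. allowed \<theta> q (\<lambda>_. 0) (Suc m))"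
    if "q \<in> sub_circle \<theta>"
    using Suc.IH[OF renorm_irrational_angle phi_in_split_circle[OF that]]
    by (simp add: allowed_renorm)
  ultimately show ?case by (auto simp: All_less_Suc2)
qed simp

context irrational_angle
begin

lemma irrational_angle_theta_seq: "irrational_angle (theta_seq \<theta> n)"
  by (induction n) (auto simp: theta_seq_Suc irrational_angle_axioms irrational_angle.renorm_irrational_angle)

lemma renorm_less_half: "\<theta> > 1/2 \<Longrightarrow> renorm \<theta> < 1/2"
  by (simp add: renorm_gt_half)

lemma infinitely_many_less_half: "\<exists>m\<ge>n. theta_seq \<theta> m < 1/2"
proof -
  interpret t: irrational_angle "theta_seq \<theta> n" by (rule irrational_angle_theta_seq)
  have "theta_seq \<theta> n < 1/2 \<or> theta_seq \<theta> (Suc n) < 1/2"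
    using t.ne_half t.renorm_less_half by (auto simp: theta_seq_Suc linorder_neq_iff)
  then show ?thesis by (meson le_refl le_SucI)
qed

sublocale proper_substitutions "\<lambda>n. sigma (theta_seq \<theta> n)" "\<lambda>n. theta_seq \<theta> n < 1/2"
proof
  fix n l
  interpret t: irrational_angle "theta_seq \<theta> n" by (rule irrational_angle_theta_seq)
  show "sigma (theta_seq \<theta> n) l = [l]" if "\<not> theta_seq \<theta> n < 1/2"
    using that t.ne_half by (intro t.sigma_gt_half) auto
  show "\<exists>r. sigma (theta_seq \<theta> n) l = A # r" if "theta_seq \<theta> n < 1/2"
    using t.sigma_starts_with_A[OF that] by blast
  show "\<exists>r. r \<noteq> [] \<and> sigma (theta_seq \<theta> n) A = A # r" if "theta_seq \<theta> n < 1/2"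
    using t.sigma_A_starts_with_A[OF that] by blast
qed (rule infinitely_many_less_half)

lemma infinitely_many_nontrivial: "infinite {n. sigma (theta_seq \<theta> n) \<noteq> (\<lambda>l. [l])}"
  unfolding infinite_nat_iff_unbounded_le
proof
  fix n
  obtain m where m: "m \<ge> n" "theta_seq \<theta> m < 1/2" using infinitely_many_less_half by blast
  then have "sigma (theta_seq \<theta> m) A \<noteq> [A]" using proper_AA[of m] by auto
  then show "\<exists>m\<ge>n. m \<in> {n. sigma (theta_seq \<theta> n) \<noteq> (\<lambda>l. [l])}" using m by auto
qed

text \<open>The first return reads the image of the first letter and ends at a point whose image
  under \<open>phi\<close> is the rotated image of p; the remaining letters are then handled by
  induction from that point.\<close>

lemma prefix_of_code_sigma:
  assumes "p \<in> sub_circle \<theta>" "prefix_of w (code (renorm \<theta>) (phi \<theta> p))"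
  shows "prefix_of (apply_subst (sigma \<theta>) w) (code \<theta> p)"
  using assms
proof (induction w arbitrary: p)
  case (Cons l w)
  interpret r: irrational_angle "renorm \<theta>" by (rule renorm_irrational_angle)
  let ?k = "length (sigma \<theta> l)"
  have l: "code (renorm \<theta>) (phi \<theta> p) 0 = l"
    and w: "prefix_of w (\<lambda>i. code (renorm \<theta>) (phi \<theta> p) (Suc i))"
    using Cons.prems by (simp_all add: prefix_of_Cons)
  note ind = induced_map[OF Cons.prems(1), unfolded l]
  have "code (renorm \<theta>) (phi \<theta> ((rot \<theta> ^^ ?k) p)) = (\<lambda>i. code (renorm \<theta>) (phi \<theta> p) (Suc i))"
    using r.code_rot_power[of 1 "phi \<theta> p"] ind(3) by simp
  then have "prefix_of (apply_subst (sigma \<theta>) w) (code \<theta> ((rot \<theta> ^^ ?k) p))"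
    using Cons.IH[OF ind(2)] w by simp
  then have "prefix_of (apply_subst (sigma \<theta>) w) (\<lambda>i. code \<theta> p (?k + i))"
    by (simp add: code_rot_power)
  then show ?case using ind(1) by (simp add: prefix_of_append) (simp add: prefix_of_def)
qed simp

lemma prefix_of_code_orbit_word:
  assumes "(rot \<theta> ^^ j) p \<in> sub_circle \<theta>"
    and "prefix_of w (code (renorm \<theta>) (phi \<theta> ((rot \<theta> ^^ j) p)))"
  shows "prefix_of (orbit_word \<theta> p j @ apply_subst (sigma \<theta>) w) (code \<theta> p)"
  using prefix_of_code_sigma[OF assms] by (simp add: prefix_of_append orbit_word_eq code_rot_power)

lemma renorm_point_in_split_circle:
  assumes "x0 \<in> split_circle \<theta>"
  shows "(\<forall>m<n. allowed \<theta> x0 j m) \<Longrightarrow> renorm_point \<theta> x0 j n \<in> split_circle (theta_seq \<theta> n)"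
proof (induction n)
  case (Suc n)
  interpret t: irrational_angle "theta_seq \<theta> n" by (rule irrational_angle_theta_seq)
  show ?case
    using Suc.prems t.phi_in_split_circle by (simp add: theta_seq_Suc allowed_def)
qed (use assms in simp)

lemma prefix_of_code_renorm_point:
  assumes "allowed \<theta> x0 j n"
    and "prefix_of w (code (theta_seq \<theta> (Suc n)) (renorm_point \<theta> x0 j (Suc n)))"
  shows "prefix_of (orbit_word (theta_seq \<theta> n) (renorm_point \<theta> x0 j n) (j n) @
      apply_subst (sigma (theta_seq \<theta> n)) w) (code (theta_seq \<theta> n) (renorm_point \<theta> x0 j n))"
proof -
  interpret t: irrational_angle "theta_seq \<theta> n" by (rule irrational_angle_theta_seq)
  show ?thesis
    using assms by (intro t.prefix_of_code_orbit_word) (simp_all add: allowed_def theta_seq_Suc)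
qed

lemma nested_word_code:
  assumes "\<forall>n. allowed \<theta> x0 j n"
  shows "nested_word (\<lambda>n. sigma (theta_seq \<theta> n))
      (\<lambda>n. orbit_word (theta_seq \<theta> n) (renorm_point \<theta> x0 j n) (j n)) (code \<theta> x0)"
  using nested_wordI[of "\<lambda>n. code (theta_seq \<theta> n) (renorm_point \<theta> x0 j n)"
      "\<lambda>n. orbit_word (theta_seq \<theta> n) (renorm_point \<theta> x0 j n) (j n)"]
    prefix_of_code_renorm_point assms by simp

lemma word_limit_code:
  assumes "\<forall>n. allowed \<theta> q (\<lambda>_. 0) n" "w \<noteq> []"
  shows "word_limit (\<lambda>n. image 0 n w) (code \<theta> q)"
  using word_limit_image[of 0 "\<lambda>n. code (theta_seq \<theta> n) (renorm_point \<theta> q (\<lambda>_. 0) n)" w]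
    prefix_of_code_renorm_point[of q "\<lambda>_. 0"] assms
  by (simp add: orbit_word_def)

lemma code_eqI:
  assumes "\<forall>n. allowed \<theta> p (\<lambda>_. 0) n" "\<forall>n. allowed \<theta> q (\<lambda>_. 0) n"
  shows "code \<theta> p = code \<theta> q"
proof
  fix i
  have "\<forall>\<^sub>F n in sequentially. i < length (image 0 n [A]) \<and> image 0 n [A] ! i = code \<theta> p i"
    "\<forall>\<^sub>F n in sequentially. i < length (image 0 n [A]) \<and> image 0 n [A] ! i = code \<theta> q i"
    using word_limit_code[of _ "[A]"] assms unfolding word_limit_def by blast+
  then have "\<forall>\<^sub>F n in sequentially. code \<theta> p i = code \<theta> q i"
    by eventually_elim auto
  then show "code \<theta> p i = code \<theta> q i" by simp
qed

text \<open>A split position reaches 0 or 1/2 after i rotations, and there the two sides lie in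
  different partition elements.\<close>

lemma code_two_sides:
  assumes "frac x \<in> split_set \<theta>" "on_circle True x" "on_circle False x"
  shows "code \<theta> (pt \<theta> True x) \<noteq> code \<theta> (pt \<theta> False x)"
proof -
  obtain m :: int and i :: nat
    where "x = of_int m - real i * \<theta> \<or> x = of_int m + 1/2 - real i * \<theta>"
    using assms(1) unfolding in_split_set_iff by blast
  then have "x + real i * \<theta> = of_int m + 0 \<or> x + real i * \<theta> = of_int m + 1/2"
    by auto
  then have "frac (x + real i * \<theta>) = frac 0 \<or> frac (x + real i * \<theta>) = frac (1/2)"
    unfolding frac_eq_frac_iff by blast
  then have "frac (x + real i * \<theta>) = 0 \<or> frac (x + real i * \<theta>) = 1/2"
    by (simp add: frac_eq)
  moreover have "code \<theta> (pt \<theta> True x) i = letter_at \<theta> True (frac (x + real i * \<theta>))"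
    using assms by (simp only: code_pt turn_power_True)
  moreover have "code \<theta> (pt \<theta> False x) i =
      letter_at \<theta> False (let y = frac (x + real i * \<theta>) in if y = 0 then 1 else y)"
    using assms by (simp only: code_pt turn_power_False)
  moreover have "letter_at \<theta> True 0 \<noteq> letter_at \<theta> False 1"
    "letter_at \<theta> True (1/2) \<noteq> letter_at \<theta> False (1/2)"
    using pos less_1 ne_half by (auto simp: letter_at_def above_def)
  ultimately have "code \<theta> (pt \<theta> True x) i \<noteq> code \<theta> (pt \<theta> False x) i"
    by (elim disjE) (simp_all only: Let_def, simp_all)
  then show ?thesis by auto
qed

end

section \<open>Endpoints of the nested intervals, and the special point\<close>

fun tilde_end :: "bool \<Rightarrow> nat \<Rightarrow> real \<Rightarrow> real" where
  "tilde_end b 0 \<theta> = (if b then 1 else 0)"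
| "tilde_end b (Suc n) \<theta> =
     (if \<theta> < 1/2 then delta \<theta> * tilde_end b n (renorm \<theta>) else 1 - tilde_end (\<not> b) n (renorm \<theta>))"

lemma tilde_end_bounds:
  "irrational_angle \<theta> \<Longrightarrow> 0 \<le> tilde_end False n \<theta> \<and> tilde_end False n \<theta> < tilde_end True n \<theta>
     \<and> tilde_end True n \<theta> \<le> 1"
proof (induction n arbitrary: \<theta>)
  case (Suc n)
  interpret irrational_angle \<theta> by fact
  note IH = Suc.IH[OF renorm_irrational_angle]
  show ?case
  proof (cases "\<theta> < 1/2")
    case True
    have "delta \<theta> * tilde_end True n (renorm \<theta>) \<le> 1 * 1"
      using IH delta_pos[OF True] delta_less_half[OF True] by (intro mult_mono) auto
    then show ?thesis using True IH delta_pos[OF True] by simp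
  next
    case False
    then show ?thesis using IH by simp
  qed
qed simp

lemma tilde_end_mono:
  "irrational_angle \<theta> \<Longrightarrow>
     tilde_end False n \<theta> \<le> tilde_end False (Suc n) \<theta> \<and> tilde_end True (Suc n) \<theta> \<le> tilde_end True n \<theta>"
proof (induction n arbitrary: \<theta>)
  case 0
  then show ?case using tilde_end_bounds[OF 0, of 1] by (simp del: tilde_end.simps(2))
next
  case (Suc n)
  interpret irrational_angle \<theta> by fact
  note IH = Suc.IH[OF renorm_irrational_angle]
  show ?case
    using IH delta_pos
    by (simp only: tilde_end.simps(2)[of _ "Suc n"] tilde_end.simps(2)[of _ n \<theta>]) (simp del: tilde_end.simps)
qed

lemma tilde_end_diff:
  assumes "irrational_angle \<theta>"
  shows "tilde_end True (Suc n) \<theta> - tilde_end False (Suc n) \<theta> \<le>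
    (if \<theta> < 1/2 then 1/2 else 1) * (tilde_end True n (renorm \<theta>) - tilde_end False n (renorm \<theta>))"
proof -
  interpret irrational_angle \<theta> by fact
  note bounds = tilde_end_bounds[OF renorm_irrational_angle, of n]
  show ?thesis
  proof (cases "\<theta> < 1/2")
    case True
    have "delta \<theta> * (tilde_end True n (renorm \<theta>) - tilde_end False n (renorm \<theta>)) \<le>
      1/2 * (tilde_end True n (renorm \<theta>) - tilde_end False n (renorm \<theta>))"
      using bounds delta_less_half[OF True] by (intro mult_right_mono) auto
    then show ?thesis using True by (simp add: algebra_simps)
  qed simp
qed

text \<open>An angle above 1/2 only reflects and gains nothing, but the next angle is then below
  1/2; so one factor 1/2 is gained for every two levels.\<close>

lemma tilde_end_diff_le:
  "irrational_angle \<theta> \<Longrightarrow> tilde_end True n \<theta> - tilde_end False n \<theta> \<le> (1/2) ^ (n div 2)"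
proof (induction n arbitrary: \<theta> rule: less_induct)
  case (less n)
  interpret irrational_angle \<theta> by fact
  interpret r: irrational_angle "renorm \<theta>" by (rule renorm_irrational_angle)
  consider "n = 0" | "n = 1" | m where "n = Suc (Suc m)"
    by (metis One_nat_def not0_implies_Suc)
  then show ?case
  proof cases
    case 2
    then show ?thesis using tilde_end_bounds[OF less.prems, of 1] by simp
  next
    case (3 m)
    let ?L = "\<lambda>n \<theta>. tilde_end True n \<theta> - tilde_end False n \<theta>"
    have nonneg: "?L n \<theta>' \<ge> 0" if "irrational_angle \<theta>'" for n \<theta>'
      using tilde_end_bounds[OF that, of n] by simp
    have "?L n \<theta> \<le> (if \<theta> < 1/2 then 1/2 else 1) * ?L (Suc m) (renorm \<theta>)"
      unfolding 3 by (rule tilde_end_diff[OF less.prems])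
    also have "\<dots> \<le> (if \<theta> < 1/2 then 1/2 else 1) *
        ((if renorm \<theta> < 1/2 then 1/2 else 1) * ?L m (renorm (renorm \<theta>)))"
      by (intro mult_left_mono tilde_end_diff r.irrational_angle_axioms) auto
    also have "\<dots> \<le> 1/2 * ?L m (renorm (renorm \<theta>))"
      using nonneg[OF r.renorm_irrational_angle, of m] renorm_less_half ne_half by auto
    also have "\<dots> \<le> 1/2 * (1/2) ^ (m div 2)"
      using less.IH[OF _ r.renorm_irrational_angle, of m] 3 by (intro mult_left_mono) auto
    finally show ?thesis by (simp add: 3)
  qed simp
qed

lemma tilde_circle_subset: "tilde_circle n \<theta> \<subseteq> split_circle \<theta>"
  using sub_circle_subset by (cases n) auto

text \<open>Pulling back by the scaling multiplies both ends by \<open>delta \<theta>\<close>.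
  Pulling back by the reflection exchanges left and right ends together with the sides, which
  explains the negated flag in \<open>tilde_end\<close>.\<close>

lemma pt_in_tilde_circle:
  "irrational_angle \<theta> \<Longrightarrow> on_circle s x \<Longrightarrow>
     pt \<theta> s x \<in> tilde_circle n \<theta> \<longleftrightarrow> above s (tilde_end False n \<theta>) x \<and> \<not> above s (tilde_end True n \<theta>) x"
proof (induction n arbitrary: \<theta> s x)
  case 0
  then show ?case by (simp add: pt_in_split_circle) (simp add: on_circle_def)
next
  case (Suc n)
  interpret irrational_angle \<theta> by fact
  note x = Suc.prems(2)
  note r = renorm_irrational_angle
  note bounds = tilde_end_bounds[OF r, of n]
  show ?case
  proof (cases "\<theta> < 1/2")
    case True
    note d = delta_pos[OF True]
    have "tilde_end True n (renorm \<theta>) * delta \<theta> \<le> 1 * delta \<theta>"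
      using bounds d by (intro mult_right_mono) auto
    then have "\<not> above s (tilde_end True n (renorm \<theta>) * delta \<theta>) x \<Longrightarrow> \<not> above s (delta \<theta>) x"
      using not_above_mono by simp
    then show ?thesis
      using True x d Suc.IH[OF r on_circle_scale[OF True x]]
      by (auto simp: pt_in_sub_circle phi_pt_lt_half above_divide mult.commute)
  next
    case False
    then have "\<theta> > 1/2" using ne_half by simp
    then show ?thesis
      using x Suc.IH[OF r on_circle_reflect[OF x]] delta_gt_half
      by (simp add: pt_in_sub_circle phi_pt_gt_half above_one_minus) (auto simp: on_circle_def)
  qed
qed

context irrational_angle
begin

lemma tilde_circles_meet: "\<exists>p. \<forall>n. p \<in> tilde_circle n \<theta>"
proof -
  define lo hi where "lo n = tilde_end False n \<theta>" and "hi n = tilde_end True n \<theta>" for n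
  have step: "lo n \<le> lo (Suc n)" "hi (Suc n) \<le> hi n" for n
    using tilde_end_mono[OF irrational_angle_axioms, of n] unfolding lo_def hi_def by blast+
  have lo_mono: "lo m \<le> lo n" if "m \<le> n" for m n
    by (rule lift_Suc_mono_le[of lo, OF step(1) that])
  have hi_mono: "hi n \<le> hi m" if "m \<le> n" for m n
    by (rule lift_Suc_antimono_le[of hi, OF step(2) that])
  have lo_hi: "lo n < hi n" for n
    using tilde_end_bounds[OF irrational_angle_axioms, of n] by (simp add: lo_def hi_def)
  have lo_less: "lo m < hi n" for m n
    using lo_mono[of m "max m n"] lo_hi[of "max m n"] hi_mono[of n "max m n"] by linarith
  define y where "y = (SUP n. lo n)"
  have bdd: "bdd_above (range lo)" using lo_less[of _ 0] by (intro bdd_aboveI2) (auto intro: less_imp_le)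
  have y: "lo n \<le> y" "y \<le> hi n" for n
    unfolding y_def using bdd lo_less by (auto intro: cSUP_upper cSUP_least less_imp_le)
  \<comment> \<open>The supremum y of the left ends needs the right side. If it is attained, the
    plus point is taken, y then being strictly below all right ends; if not, the minus point, y
    being strictly above all left ends.\<close>
  obtain s where s: "above s (lo n) y" "\<not> above s (hi n) y" for n
  proof (cases "\<exists>N. lo N = y")
    case True
    then show ?thesis using that[of True] y lo_less by (auto simp: above_def not_le)
  next
    case False
    then have "lo n < y" for n using y(1)[of n] by (metis order_le_less)
    then show ?thesis using that[of False] y(2) by (simp add: above_def not_less)
  qed
  have oc: "on_circle s y" using s[of 0] by (simp add: on_circle_def lo_def hi_def)
  then show ?thesis
    using s pt_in_tilde_circle[OF irrational_angle_axioms oc] by (auto simp: lo_def hi_def)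
qed

lemma tilde_circle_position_diff:
  assumes "p \<in> tilde_circle n \<theta>" "q \<in> tilde_circle n \<theta>"
  shows "\<bar>position p - position q\<bar> \<le> (1/2) ^ (n div 2)"
proof -
  have "tilde_end False n \<theta> \<le> position p \<and> position p \<le> tilde_end True n \<theta>"
    if "p \<in> tilde_circle n \<theta>" for p
  proof -
    have "p \<in> split_circle \<theta>" using that tilde_circle_subset by blast
    then obtain s x where "p = pt \<theta> s x" "on_circle s x" by (rule split_circle_cases)
    then show ?thesis
      using that pt_in_tilde_circle[OF irrational_angle_axioms]
      by (auto simp: above_def split: if_splits)
  qed
  from this[OF assms(1)] this[OF assms(2)] tilde_end_diff_le[OF irrational_angle_axioms, of n]
  show ?thesis by linarith
qed

text \<open>Shrinking lengths identify the positions. Opposite sides of one split position are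
  excluded since both codings are the limit of the same words (\<open>code_eqI\<close>), against
  \<open>code_two_sides\<close>.\<close>

lemma tilde_circles_unique:
  assumes "\<forall>n. p \<in> tilde_circle n \<theta>" "\<forall>n. q \<in> tilde_circle n \<theta>"
  shows "p = q"
proof -
  have circle: "p \<in> split_circle \<theta>" "q \<in> split_circle \<theta>"
    using assms tilde_circle_subset by blast+
  have "\<bar>position p - position q\<bar> \<le> (1/2) ^ n" for n
    using tilde_circle_position_diff[of p "2 * n" q] assms by simp
  moreover have "(\<lambda>n. (1/2) ^ n :: real) \<longlonglongrightarrow> 0" by (rule LIMSEQ_power_zero) simp
  ultimately have "\<bar>position p - position q\<bar> \<le> 0"
    by (intro LIMSEQ_le_const) auto
  then have pos_eq: "position p = position q" by simp
  have allowed: "\<forall>n. allowed \<theta> p (\<lambda>_. 0) n" "\<forall>n. allowed \<theta> q (\<lambda>_. 0) n"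
    using assms tilde_circle_iff_allowed[OF irrational_angle_axioms] circle by blast+
  obtain s x where p: "p = pt \<theta> s x" "on_circle s x" using split_circle_cases[OF circle(1)] .
  obtain t z where q: "q = pt \<theta> t z" "on_circle t z" using split_circle_cases[OF circle(2)] .
  have z: "z = x" using pos_eq by (simp add: p q)
  show ?thesis
  proof (cases "s = t \<or> frac x \<notin> split_set \<theta>")
    case True
    then show ?thesis by (auto simp: p q z pt_def)
  next
    case False
    then show ?thesis
      using code_two_sides[of x] code_eqI[OF allowed] p q z by (cases s; cases t) auto
  qed
qed

text \<open>Both one-sided points over \<open>0\<close> have the same image, so that reflecting \<open>0\<^sup>+\<close> to \<open>1\<^sup>-\<close>
  only affects the first letter of the coding.\<close>

lemma rot_zero: "rot \<theta> (pt \<theta> True 0) = rot \<theta> (pt \<theta> False 1)"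
proof -
  have "frac \<theta> \<notin> split_set \<theta>"
  proof
    assume "frac \<theta> \<in> split_set \<theta>"
    then obtain m :: int and i :: nat
      where "\<theta> = of_int m - real i * \<theta> \<or> \<theta> = of_int m + 1/2 - real i * \<theta>"
      unfolding in_split_set_iff by blast
    then have eq: "of_int (1 + int i) * \<theta> = of_int m \<or> of_int (1 + int i) * \<theta> = of_int m + 1/2"
      by (auto simp: algebra_simps)
    have "1/2 \<in> (\<rat> :: real set)" by (intro Rats_divide) auto
    then have "of_int m \<in> (\<rat> :: real set)" "of_int m + 1/2 \<in> (\<rat> :: real set)"
      by (auto intro: Rats_add)
    then have "of_int (1 + int i) * \<theta> \<in> \<rat>" using eq by metis
    then have "1 + int i = 0" by (rule multiple_in_Rats)
    then show False by simp
  qed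
  moreover have "turn \<theta> True 0 = \<theta>" "turn \<theta> False 1 = \<theta>"
    using pos less_1 by (simp_all add: turn_def above_def)
  moreover have "on_circle True 0" "on_circle False 1" by (simp_all add: on_circle_def above_def)
  ultimately show ?thesis by (simp add: rot_pt) (simp add: pt_def)
qed

section \<open>The coding of the orbit of zero\<close>

lemma code_Suc: "code \<theta> p (Suc i) = code \<theta> (rot \<theta> p) i"
  using code_rot_power[of 1 p] by simp

abbreviation zero_code :: "letter word" where
  "zero_code \<equiv> code \<theta> (PtP 0)"

lemma on_circle_zero: "on_circle True 0"
  by (simp add: on_circle_def above_def)

lemma PtP_zero: "PtP 0 = pt \<theta> True 0"
  by (simp add: pt_def)

lemma zero_code_0: "zero_code 0 = (if \<theta> < 1/2 then A else C)"
  using less_1 by (simp add: PtP_zero code_pt on_circle_zero letter_at_def above_def)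

lemma zero_code_1: "zero_code (Suc 0) = A"
  using pos less_1 ne_half
  by (auto simp: PtP_zero code_pt on_circle_zero letter_at_def above_def turn_def)

lemma zero_in_sub_circle: "PtP 0 \<in> sub_circle \<theta>"
proof -
  have "delta \<theta> > 0" using delta_pos delta_gt_half ne_half by (cases "\<theta> < 1/2") auto
  then show ?thesis by (simp add: PtP_zero pt_in_sub_circle on_circle_zero) (simp add: above_def)
qed

text \<open>Reflection sends the plus point at 0 to the minus point at 1, and \<open>sigma\<close>
  is the identity here. After one rotation \<open>rot_zero\<close> merges that point with the plus
  point at 0, so the codings can differ only in the first letter: the reason for
  \<open>psi\<close>.\<close>

lemma zero_code_gt_half:
  assumes "\<theta> > 1/2"
  shows "zero_code (Suc i) = code (renorm \<theta>) (PtP 0) (Suc i)"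
proof -
  interpret r: irrational_angle "renorm \<theta>" by (rule renorm_irrational_angle)
  have phi: "phi \<theta> (PtP 0) = pt (renorm \<theta>) False 1"
    unfolding PtP_zero phi_pt_gt_half[OF assms] by simp
  let ?w = "map (code (renorm \<theta>) (phi \<theta> (PtP 0))) [0..<Suc (Suc i)]"
  have "prefix_of (apply_subst (sigma \<theta>) ?w) zero_code"
    by (intro prefix_of_code_sigma zero_in_sub_circle prefix_of_map)
  then have "prefix_of ?w zero_code"
    by (simp only: apply_subst_id[OF sigma_gt_half[OF assms]])
  then have "zero_code (Suc i) = code (renorm \<theta>) (pt (renorm \<theta>) False 1) (Suc i)"
    unfolding prefix_of_def phi by (simp del: upt_Suc)
  also have "\<dots> = code (renorm \<theta>) (PtP 0) (Suc i)"
    by (simp add: r.code_Suc r.PtP_zero r.rot_zero)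
  finally show ?thesis .
qed

lemma prefix_of_zero_code:
  assumes "prefix_of w (code (renorm \<theta>) (PtP 0))"
  shows "prefix_of (sigma' \<theta> w) zero_code"
proof (cases "\<theta> < 1/2")
  case True
  interpret r: irrational_angle "renorm \<theta>" by (rule renorm_irrational_angle)
  have "phi \<theta> (pt \<theta> True 0) = pt (renorm \<theta>) True 0"
    using phi_pt_lt_half[OF True on_circle_zero] delta_pos[OF True] by (simp add: above_def)
  then have "phi \<theta> (PtP 0) = PtP 0" by (metis PtP_zero r.PtP_zero)
  then show ?thesis
    using True prefix_of_code_sigma[OF zero_in_sub_circle, of w] assms by (simp add: sigma'_def)
next
  case False
  then have "\<theta> > 1/2" using ne_half by simp
  then show ?thesis
    using False assms zero_code_0 zero_code_gt_half
    by (cases w) (simp_all add: sigma'_def prefix_of_Cons)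
qed

lemma length_omega_base:
  assumes "\<theta> < 1/2"
  shows "length (omega_base \<theta>) \<ge> 2"
  using half_digit_ge_1[OF assms] by (auto simp: omega_base_def Let_def half_digit_def)

text \<open>The origin of the words \<open>omega'\<close>: the coding of 0 at the next level begins
  with these two letters, and \<open>omega_base\<close> is a proper prefix of their image. For even
  first digit it is \<open>A\<close> and one \<open>block_Q\<close> from the first image; for odd
  first digit the images are \<open>A\<close> and \<open>block_S\<close>, and the final
  \<open>C\<close> is dropped.\<close>

lemma sigma_omega_base:
  assumes "\<theta> < 1/2"
  obtains r where "r \<noteq> []"
    "apply_subst (sigma \<theta>) [if renorm \<theta> < 1/2 then A else C, A] = omega_base \<theta> @ r"
proof (cases "even (cf_digit 1 \<theta>)")
  case True
  have g: "irrational_angle (gauss_map \<theta>)"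
    by (rule gauss_map_irrational_angle[OF irrational_angle_axioms])
  have "quot_digit \<theta> \<ge> 1" using True cf_digit_1_ge_1[OF g] by (simp add: quot_digit_def cf_digit_2)
  then obtain a where a: "quot_digit \<theta> = Suc a" by (metis Suc_le_D One_nat_def)
  let ?r = "word_power (block_Q (half_digit \<theta>)) a @ sigma \<theta> A"
  have "omega_base \<theta> = A # block_Q (half_digit \<theta>)"
    using True by (simp add: omega_base_def block_Q_def half_digit_def Let_def)
  moreover have "sigma \<theta> (if renorm \<theta> < 1/2 then A else C) = A # word_power (block_Q (half_digit \<theta>)) (Suc a)"
    by (simp add: sigma_eq[OF assms] Let_def a)
  moreover have "sigma \<theta> A \<noteq> []" using sigma_starts_with_A[OF assms] by (metis list.distinct(1))
  ultimately show ?thesis using that[of ?r] by simp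
next
  case False
  have a: "quot_digit \<theta> = 0" using False by (simp add: quot_digit_def)
  then have "\<not> renorm \<theta> < 1/2" using quot_digit_0[OF assms] by simp
  then have "apply_subst (sigma \<theta>) [if renorm \<theta> < 1/2 then A else C, A] = A # block_S (half_digit \<theta>)"
    by (simp add: sigma_eq[OF assms] Let_def a)
  then show ?thesis
    using that[of "[C]"] False by (simp add: omega_base_def block_S_def half_digit_def Let_def)
qed

lemma omega'_lt_half: "\<theta> < 1/2 \<Longrightarrow> omega' \<theta> = omega_base \<theta>"
  and omega'_gt_half: "\<theta> > 1/2 \<Longrightarrow> omega' \<theta> = psi (omega_base (renorm \<theta>))"
  using cf_digit_1_eq_1_iff by (auto simp: omega'_def)

lemma length_psi [simp]: "length (psi w) = length w"
  by (cases w) simp_all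

lemma length_omega': "length (omega' \<theta>) \<ge> 2"
proof (cases "\<theta> < 1/2")
  case True
  then show ?thesis by (simp add: omega'_lt_half length_omega_base)
next
  case False
  then have "\<theta> > 1/2" using ne_half by simp
  then show ?thesis
    using irrational_angle.length_omega_base[OF renorm_irrational_angle] renorm_less_half
    by (simp add: omega'_gt_half)
qed

lemma prefix_of_omega_base:
  assumes "\<theta> < 1/2"
  shows "prefix_of (omega_base \<theta>) zero_code"
proof -
  interpret r: irrational_angle "renorm \<theta>" by (rule renorm_irrational_angle)
  have "prefix_of [if renorm \<theta> < 1/2 then A else C, A] (code (renorm \<theta>) (PtP 0))"
    by (simp add: prefix_of_Cons r.zero_code_0 r.zero_code_1)
  from prefix_of_zero_code[OF this]
  have "prefix_of (apply_subst (sigma \<theta>) [if renorm \<theta> < 1/2 then A else C, A]) zero_code"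
    unfolding sigma'_def if_P[OF assms] .
  moreover obtain r where
    "apply_subst (sigma \<theta>) [if renorm \<theta> < 1/2 then A else C, A] = omega_base \<theta> @ r"
    using sigma_omega_base[OF assms] by blast
  ultimately show ?thesis by (simp only: prefix_of_append)
qed

lemma prefix_of_omega': "prefix_of (omega' \<theta>) zero_code"
proof (cases "\<theta> < 1/2")
  case True
  then show ?thesis by (simp add: omega'_lt_half prefix_of_omega_base)
next
  case False
  then have gt: "\<theta> > 1/2" using ne_half by simp
  interpret r: irrational_angle "renorm \<theta>" by (rule renorm_irrational_angle)
  have "prefix_of (omega_base (renorm \<theta>)) (code (renorm \<theta>) (PtP 0))"
    using renorm_less_half[OF gt] by (rule r.prefix_of_omega_base)
  from prefix_of_zero_code[OF this] show ?thesis
    using False gt by (simp add: omega'_gt_half sigma'_def)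
qed

lemma sigma'_omega':
  obtains r where "sigma' \<theta> (omega' (renorm \<theta>)) = omega' \<theta> @ r" "\<theta> < 1/2 \<Longrightarrow> r \<noteq> []"
proof -
  interpret r: irrational_angle "renorm \<theta>" by (rule renorm_irrational_angle)
  let ?l = "if renorm \<theta> < 1/2 then A else C"
  show ?thesis
  proof (cases "\<theta> < 1/2")
    case True
    obtain l l' v where v: "omega' (renorm \<theta>) = l # l' # v"
      using r.length_omega' by (metis One_nat_def Suc_1 Suc_le_length_iff)
    then have "l = ?l" "l' = A"
      using r.prefix_of_omega' by (simp_all add: prefix_of_Cons r.zero_code_0 r.zero_code_1)
    then have "sigma' \<theta> (omega' (renorm \<theta>)) = apply_subst (sigma \<theta>) [?l, A] @ apply_subst (sigma \<theta>) v"
      using True v by (simp add: sigma'_def)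
    moreover obtain r where "r \<noteq> []" "apply_subst (sigma \<theta>) [?l, A] = omega_base \<theta> @ r"
      using sigma_omega_base[OF True] by blast
    ultimately show ?thesis
      using that[of "r @ apply_subst (sigma \<theta>) v"] True by (simp add: omega'_lt_half)
  next
    case False
    then have gt: "\<theta> > 1/2" using ne_half by simp
    then show ?thesis
      using that[of "[]"] False renorm_less_half by (simp add: sigma'_def omega'_gt_half r.omega'_lt_half)
  qed
qed

text \<open>\<open>psi\<close> is not a monoid homomorphism, as it changes only the first letter of
  the whole word. What survives is that extending a nonempty word extends its image by at least as
  many letters.\<close>

lemma sigma'_append:
  assumes "v \<noteq> []"
  obtains t where "sigma' \<theta> (v @ w) = sigma' \<theta> v @ t" "sigma' \<theta> v \<noteq> []" "length w \<le> length t"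
proof (cases "\<theta> < 1/2")
  case True
  have ne: "sigma \<theta> l \<noteq> []" for l
    using sigma_starts_with_A[OF True] by (metis list.distinct(1))
  have "length v \<le> length (apply_subst (sigma \<theta>) v)" "length w \<le> length (apply_subst (sigma \<theta>) w)"
    using ne by (intro length_apply_subst_ge; simp)+
  then show ?thesis
    using that[of "apply_subst (sigma \<theta>) w"] True assms by (force simp: sigma'_def)
next
  case False
  then show ?thesis using that[of w] assms by (cases v) (simp_all add: sigma'_def)
qed

abbreviation image' :: "nat \<Rightarrow> letter list \<Rightarrow> letter list" where
  "image' n \<equiv> compose_seg (\<lambda>i. sigma' (theta_seq \<theta> i)) 0 n"

lemma prefix_of_image': "prefix_of w (code (theta_seq \<theta> n) (PtP 0)) \<Longrightarrow> prefix_of (image' n w) zero_code"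
proof (induction n arbitrary: w)
  case (Suc n)
  then show ?case
    using irrational_angle.prefix_of_zero_code[OF irrational_angle_theta_seq]
    by (simp add: compose_seg_Suc theta_seq_Suc)
qed simp

lemma length_image'_append:
  "v \<noteq> [] \<Longrightarrow> length (image' n v) + length w \<le> length (image' n (v @ w))"
proof (induction n arbitrary: v w)
  case (Suc n)
  obtain t where t: "sigma' (theta_seq \<theta> n) (v @ w) = sigma' (theta_seq \<theta> n) v @ t"
    "sigma' (theta_seq \<theta> n) v \<noteq> []" "length w \<le> length t"
    using irrational_angle.sigma'_append[OF irrational_angle_theta_seq Suc.prems] by blast
  then show ?case using Suc.IH[of "sigma' (theta_seq \<theta> n) v" t] by (simp add: compose_seg_Suc)
qed simp

text \<open>All these words are prefixes of \<open>zero_code\<close>. By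
  \<open>sigma'_omega'\<close> passing to the next level adds a surplus, nonempty whenever the angle
  is below 1/2, and \<open>length_image'_append\<close> shows that the outer maps do not lose
  it.\<close>

lemma word_limit_zero_code: "word_limit (\<lambda>n. image' n (omega' (theta_seq \<theta> n))) zero_code"
proof (rule word_limitI)
  show "prefix_of (image' n (omega' (theta_seq \<theta> n))) zero_code" for n
    by (intro prefix_of_image' irrational_angle.prefix_of_omega' irrational_angle_theta_seq)
  have grow: "length (image' n (omega' (theta_seq \<theta> n))) + (if theta_seq \<theta> n < 1/2 then 1 else 0)
      \<le> length (image' (Suc n) (omega' (theta_seq \<theta> (Suc n))))" for n
  proof -
    interpret t: irrational_angle "theta_seq \<theta> n" by (rule irrational_angle_theta_seq)
    obtain r where r: "sigma' (theta_seq \<theta> n) (omega' (theta_seq \<theta> (Suc n))) = omega' (theta_seq \<theta> n) @ r"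
      "theta_seq \<theta> n < 1/2 \<Longrightarrow> r \<noteq> []"
      using t.sigma'_omega' unfolding theta_seq_Suc by blast
    have "(if theta_seq \<theta> n < 1/2 then 1 else 0) \<le> length r"
      using r(2) by (cases r) auto
    moreover have "omega' (theta_seq \<theta> n) \<noteq> []" using t.length_omega' by auto
    ultimately show ?thesis
      using length_image'_append[of "omega' (theta_seq \<theta> n)" n r] r(1) by (simp add: compose_seg_Suc)
  qed
  show "\<forall>\<^sub>F n in sequentially. L \<le> length (image' n (omega' (theta_seq \<theta> n)))" for L
  proof (rule eventually_length_ge)
    show "length (image' n (omega' (theta_seq \<theta> n))) \<le>
        length (image' (Suc n) (omega' (theta_seq \<theta> (Suc n))))" for n
      using grow[of n] by simp
    show "\<exists>m\<ge>n. length (image' m (omega' (theta_seq \<theta> m))) <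
        length (image' (Suc m) (omega' (theta_seq \<theta> (Suc m))))" for n
    proof -
      obtain m where "m \<ge> n" "theta_seq \<theta> m < 1/2" using infinitely_many_less_half by blast
      then show ?thesis using grow[of m] by (intro exI[of _ m]) simp
    qed
  qed
qed

end

theorem theorem1p1:
  fixes \<theta> x :: real
  assumes "0 < \<theta>" "\<theta> < 1" "\<theta> \<notin> \<rat>" "0 \<le> x" "x < 1"
  shows
    "infinite {n. sigma (theta_seq \<theta> n) \<noteq> (\<lambda>l. [l])}
     \<and>
     (\<forall>x0 \<in> lifts \<theta> x.
        (\<forall>j n. (\<forall>m<n. allowed \<theta> x0 j m) \<longrightarrow>
           (\<exists>k. (rot (theta_seq \<theta> n) ^^ k) (renorm_point \<theta> x0 j n) \<in> sub_circle (theta_seq \<theta> n))) \<and>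
        (\<forall>j. (\<forall>n. allowed \<theta> x0 j n) \<longrightarrow>
           (\<forall>n. renorm_point \<theta> x0 j n \<in> split_circle (theta_seq \<theta> n)) \<and>
           (\<exists>u. nested_word (\<lambda>n. sigma (theta_seq \<theta> n))
                  (\<lambda>n. orbit_word (theta_seq \<theta> n) (renorm_point \<theta> x0 j n) (j n)) u \<and>
                encodes_up_to_two_errors \<theta> x u \<and>
                encodes_up_to_endpoints \<theta> x u)))
     \<and>
     (\<exists>p. (\<Inter>n. tilde_circle n \<theta>) = {p} \<and>
        (\<forall>q \<in> split_circle \<theta>. (\<forall>n. allowed \<theta> q (\<lambda>_. 0) n) \<longleftrightarrow> q = p) \<and>
        (\<exists>y \<in> {0..<1}. p \<in> lifts \<theta> y \<and>
          (\<forall>w. w \<noteq> [] \<longrightarrow>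
            (\<exists>u. word_limit
                   (\<lambda>n. compose_seg (\<lambda>i. apply_subst (sigma (theta_seq \<theta> i))) 0 n w) u \<and>
                 split_encodes_orbit \<theta> p u \<and>
                 encodes_up_to_two_errors \<theta> y u \<and>
                 encodes_up_to_endpoints \<theta> y u))))
     \<and>
     (\<exists>u. word_limit
            (\<lambda>n. compose_seg (\<lambda>i. sigma' (theta_seq \<theta> i)) 0 n (omega' (theta_seq \<theta> n))) u \<and>
          split_encodes_orbit \<theta> (PtP 0) u \<and>
          encodes_orbit (half_open_part \<theta>) \<theta> 0 u)"
proof -
  interpret irrational_angle \<theta> using assms by unfold_locales
  have encodes: "encodes_up_to_two_errors \<theta> y (code \<theta> p)" "encodes_up_to_endpoints \<theta> y (code \<theta> p)"
    if "p \<in> lifts \<theta> y" "0 \<le> y" "y < 1" for p y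
    using that encodes_up_to_endpoints_code encodes_up_to_two_errorsI by blast+
  have arbitrary:
    "(\<forall>j n. (\<forall>m<n. allowed \<theta> x0 j m) \<longrightarrow>
        (\<exists>k. (rot (theta_seq \<theta> n) ^^ k) (renorm_point \<theta> x0 j n) \<in> sub_circle (theta_seq \<theta> n))) \<and>
     (\<forall>j. (\<forall>n. allowed \<theta> x0 j n) \<longrightarrow>
        (\<forall>n. renorm_point \<theta> x0 j n \<in> split_circle (theta_seq \<theta> n)) \<and>
        (\<exists>u. nested_word (\<lambda>n. sigma (theta_seq \<theta> n))
               (\<lambda>n. orbit_word (theta_seq \<theta> n) (renorm_point \<theta> x0 j n) (j n)) u \<and>
             encodes_up_to_two_errors \<theta> x u \<and>
             encodes_up_to_endpoints \<theta> x u))"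
    if "x0 \<in> lifts \<theta> x" for x0
  proof (intro conjI allI impI)
    have x0: "x0 \<in> split_circle \<theta>" using that assms by (auto simp: split_circle_def)
    show "\<exists>k. (rot (theta_seq \<theta> n) ^^ k) (renorm_point \<theta> x0 j n) \<in> sub_circle (theta_seq \<theta> n)"
      if "\<forall>m<n. allowed \<theta> x0 j m" for j n
      by (intro irrational_angle.reaches_sub_circle irrational_angle_theta_seq
          renorm_point_in_split_circle x0 that)
    show "renorm_point \<theta> x0 j n \<in> split_circle (theta_seq \<theta> n)" if "\<forall>n. allowed \<theta> x0 j n" for j n
      using that by (intro renorm_point_in_split_circle x0) simp
    show "\<exists>u. nested_word (\<lambda>n. sigma (theta_seq \<theta> n))
               (\<lambda>n. orbit_word (theta_seq \<theta> n) (renorm_point \<theta> x0 j n) (j n)) u \<and>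
             encodes_up_to_two_errors \<theta> x u \<and> encodes_up_to_endpoints \<theta> x u"
      if "\<forall>n. allowed \<theta> x0 j n" for j
      using nested_word_code[OF that] encodes[OF \<open>x0 \<in> lifts \<theta> x\<close> assms(4,5)] by blast
  qed
  obtain p where p: "\<forall>n. p \<in> tilde_circle n \<theta>" using tilde_circles_meet by blast
  have p_circle: "p \<in> split_circle \<theta>" using p tilde_circle_subset by blast
  have uniq: "q = p" if "\<forall>n. q \<in> tilde_circle n \<theta>" for q
    by (rule tilde_circles_unique[OF that p])
  have inter: "(\<Inter>n. tilde_circle n \<theta>) = {p}"
  proof (intro equalityI subsetI)
    show "q \<in> {p}" if "q \<in> (\<Inter>n. tilde_circle n \<theta>)" for q
      using that uniq[of q] by simp
  qed (use p in simp)
  have special: "(\<forall>n. allowed \<theta> q (\<lambda>_. 0) n) \<longleftrightarrow> q = p" if "q \<in> split_circle \<theta>" for q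
  proof -
    have "(\<forall>n. allowed \<theta> q (\<lambda>_. 0) n) \<longleftrightarrow> (\<forall>n. q \<in> tilde_circle n \<theta>)"
      using tilde_circle_iff_allowed[OF irrational_angle_axioms that] by blast
    then show ?thesis using p uniq[of q] by metis
  qed
  obtain y where y: "y \<in> {0..<1}" "p \<in> lifts \<theta> y" using p_circle by (auto simp: split_circle_def)
  have limit: "\<exists>u. word_limit (\<lambda>n. compose_seg (\<lambda>i. apply_subst (sigma (theta_seq \<theta> i))) 0 n w) u \<and>
      split_encodes_orbit \<theta> p u \<and> encodes_up_to_two_errors \<theta> y u \<and> encodes_up_to_endpoints \<theta> y u"
    if "w \<noteq> []" for w
  proof (intro exI conjI)
    show "word_limit (\<lambda>n. compose_seg (\<lambda>i. apply_subst (sigma (theta_seq \<theta> i))) 0 n w) (code \<theta> p)"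
      using special[OF p_circle] that by (intro word_limit_code) simp_all
    show "split_encodes_orbit \<theta> p (code \<theta> p)" using split_encodes_orbit_iff[OF p_circle] by simp
  qed (use encodes y in auto)
  have zero: "split_encodes_orbit \<theta> (PtP 0) zero_code"
    "encodes_orbit (half_open_part \<theta>) \<theta> 0 zero_code"
    using split_encodes_orbit_iff zero_in_sub_circle sub_circle_subset
      encodes_orbit_True[OF on_circle_zero] PtP_zero by auto
  show ?thesis
  proof (intro conjI ballI)
    show "\<exists>p. (\<Inter>n. tilde_circle n \<theta>) = {p} \<and>
        (\<forall>q \<in> split_circle \<theta>. (\<forall>n. allowed \<theta> q (\<lambda>_. 0) n) \<longleftrightarrow> q = p) \<and>
        (\<exists>y \<in> {0..<1}. p \<in> lifts \<theta> y \<and>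
          (\<forall>w. w \<noteq> [] \<longrightarrow>
            (\<exists>u. word_limit
                   (\<lambda>n. compose_seg (\<lambda>i. apply_subst (sigma (theta_seq \<theta> i))) 0 n w) u \<and>
                 split_encodes_orbit \<theta> p u \<and>
                 encodes_up_to_two_errors \<theta> y u \<and>
                 encodes_up_to_endpoints \<theta> y u)))"
      using inter special limit by (intro exI[of _ p] conjI ballI bexI[OF _ y(1)] y(2) allI impI) simp_all
    show "\<exists>u. word_limit (\<lambda>n. compose_seg (\<lambda>i. sigma' (theta_seq \<theta> i)) 0 n (omega' (theta_seq \<theta> n))) u \<and>
          split_encodes_orbit \<theta> (PtP 0) u \<and> encodes_orbit (half_open_part \<theta>) \<theta> 0 u"
      by (rule exI[of _ zero_code], intro conjI word_limit_zero_code zero)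
  qed (fact infinitely_many_nontrivial, (use arbitrary in blast)+)
qed

end
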